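(* Let $\gamma>1$, $\rho_\pm>0$ and $u_+<u_-$. For small $\epsilon_1,\epsilon_2>0$, assume $(\rho^{\epsilon_1\epsilon_2},u^{\epsilon_1\epsilon_2})$ is the two-shock wave solution (described in the context) of $$\rho_t+(\rho u-2\epsilon_1u)_x=0,\qquad(\rho u)_t+\Big(\rho u^2-\epsilon_1u^2+\epsilon_2\frac{\rho^\gamma}{\gamma}\Big)_x=0$$ with Riemann data $(\rho,u)(0,x)=(\rho_-,u_-)$ for $x<0$ and $(\rho_+,u_+)$ for $x>0$. Then, as $\epsilon_1,\epsilon_2\to0$, $\rho^{\epsilon_1\epsilon_2}$ and $\rho^{\epsilon_1\epsilon_2}u^{\epsilon_1\epsilon_2}$ converge in the sense of distributions, and their limits are each the sum of a step function and a $\delta$-function supported on $S=\{(t,\sigma t):t\ge0\}$, with weights $$\frac{t}{\sqrt{1+\sigma^2}}\big(\sigma[\rho]-[\rho u]\big)\quad\text{and}\quad\frac{t}{\sqrt{1+\sigma^2}}\big(\sigma[\rho u]-[\rho u^2]\big),$$ respectively, where $\sigma=\dfrac{\sqrt{\rho_-}u_-+\sqrt{\rho_+}u_+}{\sqrt{\rho_-}+\sqrt{\rho_+}}$. These limits form a delta shock solution of the zero-pressure system $$\rho_t+(\rho u)_x=0,\qquad(\rho u)_t+(\rho u^2)_x=0$$ with the same Riemann data.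
   Context: The perturbed system is considered for densities $\rho\ge2\epsilon_1$; $[g]=g_+-g_-$, e.g. $[\rho u]=\rho_+u_+-\rho_-u_-$. Two-shock wave solution: with $\xi=x/t$, $$(\rho^{\epsilon_1\epsilon_2},u^{\epsilon_1\epsilon_2})(\xi)=\begin{cases}(\rho_-,u_-),&\xi<\sigma_1^{\epsilon_1\epsilon_2},\\(\rho_*^{\epsilon_1\epsilon_2},u_*^{\epsilon_1\epsilon_2}),&\sigma_1^{\epsilon_1\epsilon_2}<\xi<\sigma_2^{\epsilon_1\epsilon_2},\\(\rho_+,u_+),&\xi>\sigma_2^{\epsilon_1\epsilon_2},\end{cases}$$ where $(\rho_-,u_-)$ is joined to $(\rho_*^{\epsilon_1\epsilon_2},u_*^{\epsilon_1\epsilon_2})$ by a backward shock of speed $\sigma_1^{\epsilon_1\epsilon_2}$, and $(\rho_*^{\epsilon_1\epsilon_2},u_*^{\epsilon_1\epsilon_2})$ to $(\rho_+,u_+)$ by a forward shock of speed $\sigma_2^{\epsilon_1\epsilon_2}$. A shock of speed $s$ from a left state $(\rho_l,u_l)$ to a right state $(\rho_r,u_r)$ satisfies the Rankine–Hugoniot relations $$s(\rho_r-\rho_l)=(\rho_r-2\epsilon_1)u_r-(\rho_l-2\epsilon_1)u_l,$$ $$s(\rho_ru_r-\rho_lu_l)=(\rho_r-\epsilon_1)u_r^2-(\rho_l-\epsilon_1)u_l^2+\tfrac{\epsilon_2}{\gamma}(\rho_r^\gamma-\rho_l^\gamma),$$ and $$u_r-u_l=-\sqrt{\frac{\epsilon_2(\rho_r-\rho_l)(\rho_r^\gamma-\rho_l^\gamma)}{\gamma(\rho_l\rho_r-\epsilon_1(\rho_l+\rho_r))}},$$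 with $\rho_r>\rho_l$ for a backward shock and $\rho_r<\rho_l$ for a forward shock. Thus $\rho_*^{\epsilon_1\epsilon_2}>\max(\rho_-,\rho_+)$. For a line $S=\{(t,st):t\ge0\}$ and weight $w$, $\langle w\delta_S,\varphi\rangle=\int_0^\infty w(t)\varphi(t,st)\sqrt{1+s^2}\,dt$ for $\varphi\in C_0^\infty(\mathbb{R}^+\times\mathbb{R})$. A delta shock solution of the zero-pressure system with the Riemann data is $\rho=\rho_0+w\delta_S$, $u=u_0$, where $(\rho_0,u_0)(t,x)=(\rho_-,u_-)$ for $x<st$ and $(\rho_+,u_+)$ for $x>st$, and $s$ is the velocity assigned to the singular part. It satisfies $\langle\rho,\varphi_t\rangle+\langle\rho u,\varphi_x\rangle=0$ and $\langle\rho u,\varphi_t\rangle+\langle\rho u^2,\varphi_x\rangle=0$ for all $\varphi\in C_0^\infty(\mathbb{R}^+\times\mathbb{R})$, where $$\langle\rho,\varphi\rangle=\iint\rho_0\varphi\,dx\,dt+\langle w\delta_S,\varphi\rangle,\quad\langle\rho u,\varphi\rangle=\iint\rho_0u_0\varphi\,dx\,dt+\langle sw\delta_S,\varphi\rangle,\quad\langle\rho u^2,\varphi\rangle=\iint\rho_0u_0^2\varphi\,dx\,dt+\langle s^2w\delta_S,\varphi\rangle,$$ together with the entropy condition $u_+<s<u_-$. *)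

theory Defs
  imports "HOL-Analysis.Analysis"
begin

text \<open>Points of the plane are pairs \<open>(t, x)\<close>. Test functions are functions on the whole plane
  whose support is a compact subset of the open half-plane \<open>t > 0\<close>. The half-plane is open because
  the weak formulations below carry no initial-data term.\<close>

definition partial_t :: "(real \<times> real \<Rightarrow> real) \<Rightarrow> real \<times> real \<Rightarrow> real" where
  "partial_t \<phi> = (\<lambda>(t, x). deriv (\<lambda>\<tau>. \<phi> (\<tau>, x)) t)"

definition partial_x :: "(real \<times> real \<Rightarrow> real) \<Rightarrow> real \<times> real \<Rightarrow> real" where
  "partial_x \<phi> = (\<lambda>(t, x). deriv (\<lambda>y. \<phi> (t, y)) x)"

primrec C_k :: "nat \<Rightarrow> (real \<times> real \<Rightarrow> real) \<Rightarrow> bool" where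
  "C_k 0 \<phi> \<longleftrightarrow> continuous_on UNIV \<phi>"
| "C_k (Suc k) \<phi> \<longleftrightarrow>
     (\<forall>p. \<phi> differentiable (at p)) \<and> C_k k (partial_t \<phi>) \<and> C_k k (partial_x \<phi>)"

definition half_plane :: "(real \<times> real) set" where
  "half_plane = {0<..} \<times> UNIV"

definition test_function :: "(real \<times> real \<Rightarrow> real) \<Rightarrow> bool" where
  "test_function \<phi> \<longleftrightarrow>
     (\<forall>k. C_k k \<phi>) \<and> compact (closure {p. \<phi> p \<noteq> 0}) \<and> closure {p. \<phi> p \<noteq> 0} \<subseteq> half_plane"

definition regular_distr :: "(real \<times> real \<Rightarrow> real) \<Rightarrow> (real \<times> real \<Rightarrow> real) \<Rightarrow> real" where
  "regular_distr g \<phi> = (LINT p:half_plane|lborel. g p * \<phi> p)"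

definition delta_distr :: "real \<Rightarrow> (real \<Rightarrow> real) \<Rightarrow> (real \<times> real \<Rightarrow> real) \<Rightarrow> real" where
  "delta_distr s w \<phi> = (LINT t:{0..}|lborel. w t * \<phi> (t, s * t) * sqrt (1 + s\<^sup>2))"

definition converges_in_distributions ::
  "('i \<Rightarrow> real \<times> real \<Rightarrow> real) \<Rightarrow> ((real \<times> real \<Rightarrow> real) \<Rightarrow> real) \<Rightarrow> 'i filter \<Rightarrow> bool" where
  "converges_in_distributions g L F \<longleftrightarrow>
     (\<forall>\<phi>. test_function \<phi> \<longrightarrow> ((\<lambda>i. regular_distr (g i) \<phi>) \<longlongrightarrow> L \<phi>) F)"

text \<open>The value on the line \<open>x = s * t\<close>, a null set, is immaterial.\<close>

definition step :: "real \<Rightarrow> real \<Rightarrow> real \<Rightarrow> real \<times> real \<Rightarrow> real" where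
  "step s a b = (\<lambda>(t, x). if x < s * t then a else b)"

text \<open>The subscripts \<open>l\<close> and \<open>r\<close> denote the states to the left and right of a single shock;
  \<open>m\<close> and \<open>p\<close> (minus and plus) the Riemann data.\<close>

definition shock :: "real \<Rightarrow> real \<Rightarrow> real \<Rightarrow> real \<Rightarrow> real \<Rightarrow> real \<Rightarrow> real \<Rightarrow> real \<Rightarrow> bool" where
  "shock \<gamma> \<epsilon>\<^sub>1 \<epsilon>\<^sub>2 s \<rho>\<^sub>l u\<^sub>l \<rho>\<^sub>r u\<^sub>r \<longleftrightarrow>
     \<rho>\<^sub>l \<ge> 2 * \<epsilon>\<^sub>1 \<and> \<rho>\<^sub>r \<ge> 2 * \<epsilon>\<^sub>1 \<and>
     s * (\<rho>\<^sub>r - \<rho>\<^sub>l) = (\<rho>\<^sub>r - 2 * \<epsilon>\<^sub>1) * u\<^sub>r - (\<rho>\<^sub>l - 2 * \<epsilon>\<^sub>1) * u\<^sub>l \<and>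
     s * (\<rho>\<^sub>r * u\<^sub>r - \<rho>\<^sub>l * u\<^sub>l) =
       (\<rho>\<^sub>r - \<epsilon>\<^sub>1) * u\<^sub>r\<^sup>2 - (\<rho>\<^sub>l - \<epsilon>\<^sub>1) * u\<^sub>l\<^sup>2 + \<epsilon>\<^sub>2 / \<gamma> * (\<rho>\<^sub>r powr \<gamma> - \<rho>\<^sub>l powr \<gamma>) \<and>
     u\<^sub>r - u\<^sub>l = - sqrt (\<epsilon>\<^sub>2 * (\<rho>\<^sub>r - \<rho>\<^sub>l) * (\<rho>\<^sub>r powr \<gamma> - \<rho>\<^sub>l powr \<gamma>) /
                       (\<gamma> * (\<rho>\<^sub>l * \<rho>\<^sub>r - \<epsilon>\<^sub>1 * (\<rho>\<^sub>l + \<rho>\<^sub>r))))"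

definition backward_shock ::
  "real \<Rightarrow> real \<Rightarrow> real \<Rightarrow> real \<Rightarrow> real \<Rightarrow> real \<Rightarrow> real \<Rightarrow> real \<Rightarrow> bool" where
  "backward_shock \<gamma> \<epsilon>\<^sub>1 \<epsilon>\<^sub>2 s \<rho>\<^sub>l u\<^sub>l \<rho>\<^sub>r u\<^sub>r \<longleftrightarrow> shock \<gamma> \<epsilon>\<^sub>1 \<epsilon>\<^sub>2 s \<rho>\<^sub>l u\<^sub>l \<rho>\<^sub>r u\<^sub>r \<and> \<rho>\<^sub>r > \<rho>\<^sub>l"

definition forward_shock ::
  "real \<Rightarrow> real \<Rightarrow> real \<Rightarrow> real \<Rightarrow> real \<Rightarrow> real \<Rightarrow> real \<Rightarrow> real \<Rightarrow> bool" where
  "forward_shock \<gamma> \<epsilon>\<^sub>1 \<epsilon>\<^sub>2 s \<rho>\<^sub>l u\<^sub>l \<rho>\<^sub>r u\<^sub>r \<longleftrightarrow> shock \<gamma> \<epsilon>\<^sub>1 \<epsilon>\<^sub>2 s \<rho>\<^sub>l u\<^sub>l \<rho>\<^sub>r u\<^sub>r \<and> \<rho>\<^sub>r < \<rho>\<^sub>l"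

text \<open>\<open>\<rho>\<close> and \<open>u\<close> are functions of the similarity variable \<open>\<xi> = x / t\<close>; their values at the
  two shock speeds are left unspecified. The ordering \<open>\<sigma>\<^sub>1 < \<sigma>\<^sub>2\<close> need not be imposed:
  the Rankine-Hugoniot relations place the speed of the backward shock below, and that of the
  forward shock above, the intermediate velocity (strictly where the outer density exceeds
  \<open>2 * \<epsilon>\<^sub>1\<close>).\<close>

definition two_shock_solution ::
  "real \<Rightarrow> real \<Rightarrow> real \<Rightarrow> real \<Rightarrow> real \<Rightarrow> real \<Rightarrow> real \<Rightarrow> (real \<Rightarrow> real) \<Rightarrow> (real \<Rightarrow> real) \<Rightarrow> bool" where
  "two_shock_solution \<gamma> \<epsilon>\<^sub>1 \<epsilon>\<^sub>2 \<rho>\<^sub>m u\<^sub>m \<rho>\<^sub>p u\<^sub>p \<rho> u \<longleftrightarrow>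
     (\<exists>\<rho>\<^sub>s u\<^sub>s \<sigma>\<^sub>1 \<sigma>\<^sub>2.
        backward_shock \<gamma> \<epsilon>\<^sub>1 \<epsilon>\<^sub>2 \<sigma>\<^sub>1 \<rho>\<^sub>m u\<^sub>m \<rho>\<^sub>s u\<^sub>s \<and>
        forward_shock \<gamma> \<epsilon>\<^sub>1 \<epsilon>\<^sub>2 \<sigma>\<^sub>2 \<rho>\<^sub>s u\<^sub>s \<rho>\<^sub>p u\<^sub>p \<and>
        (\<forall>\<xi>. (\<xi> < \<sigma>\<^sub>1 \<longrightarrow> \<rho> \<xi> = \<rho>\<^sub>m \<and> u \<xi> = u\<^sub>m) \<and>
             (\<sigma>\<^sub>1 < \<xi> \<and> \<xi> < \<sigma>\<^sub>2 \<longrightarrow> \<rho> \<xi> = \<rho>\<^sub>s \<and> u \<xi> = u\<^sub>s) \<and>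
             (\<sigma>\<^sub>2 < \<xi> \<longrightarrow> \<rho> \<xi> = \<rho>\<^sub>p \<and> u \<xi> = u\<^sub>p)))"

text \<open>\<open>R\<close> and \<open>M\<close> are the distributions \<open>\<rho>\<close> and \<open>\<rho> u\<close>, and \<open>Q\<close> is \<open>\<rho> u\<^sup>2\<close>. The velocity takes the
  value \<open>s\<close> on the singular part, which is how the weights \<open>s w\<close> and \<open>s\<^sup>2 w\<close> arise.\<close>

definition delta_shock_solution ::
  "real \<Rightarrow> real \<Rightarrow> real \<Rightarrow> real \<Rightarrow> real \<Rightarrow> (real \<Rightarrow> real) \<Rightarrow>
   ((real \<times> real \<Rightarrow> real) \<Rightarrow> real) \<Rightarrow> ((real \<times> real \<Rightarrow> real) \<Rightarrow> real) \<Rightarrow> bool" where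
  "delta_shock_solution \<rho>\<^sub>m u\<^sub>m \<rho>\<^sub>p u\<^sub>p s w R M \<longleftrightarrow>
     (\<exists>Q. (\<forall>\<phi>. test_function \<phi> \<longrightarrow>
             R \<phi> = regular_distr (step s \<rho>\<^sub>m \<rho>\<^sub>p) \<phi> + delta_distr s w \<phi> \<and>
             M \<phi> = regular_distr (step s (\<rho>\<^sub>m * u\<^sub>m) (\<rho>\<^sub>p * u\<^sub>p)) \<phi>
                  + delta_distr s (\<lambda>t. s * w t) \<phi> \<and>
             Q \<phi> = regular_distr (step s (\<rho>\<^sub>m * u\<^sub>m\<^sup>2) (\<rho>\<^sub>p * u\<^sub>p\<^sup>2)) \<phi>
                  + delta_distr s (\<lambda>t. s\<^sup>2 * w t) \<phi>) \<and>
          (\<forall>\<phi>. test_function \<phi> \<longrightarrow>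
             R (partial_t \<phi>) + M (partial_x \<phi>) = 0 \<and>
             M (partial_t \<phi>) + Q (partial_x \<phi>) = 0)) \<and>
     u\<^sub>p < s \<and> s < u\<^sub>m"

end

theory Submission
  imports Defs
begin

text \<open>
  \<^bold>\<open>The intermediate state.\<close> If the intermediate density \<open>\<rho>\<^sub>s\<close> stayed bounded, both velocity jumps
  would be of order at most \<open>sqrt \<epsilon>\<^sub>2\<close>, but together they have to bridge the fixed gap \<open>u\<^sub>m - u\<^sub>p > 0\<close>;
  hence \<open>\<rho>\<^sub>s\<close> tends to infinity. The squared jump towards an outer density \<open>\<rho>\<close> is
  \<open>\<epsilon>\<^sub>2 \<rho>\<^sub>s powr \<gamma> / \<gamma>\<close>, which does not depend on \<open>\<rho>\<close>, times a factor that tends to \<open>1 / \<rho>\<close>. So the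
  gap is split in the ratio \<open>1 / sqrt \<rho>\<^sub>m : 1 / sqrt \<rho>\<^sub>p\<close>, which says that the intermediate
  velocity tends to \<open>\<sigma>\<close>. The mass relation of each shock puts its speed within \<open>O(1 / \<rho>\<^sub>s)\<close> of the
  intermediate velocity, so both speeds tend to \<open>\<sigma>\<close>. Adding the two mass relations (and likewise the
  two momentum relations) cancels the unbounded fluxes of the intermediate state and gives the limit
  of \<open>\<rho>\<^sub>s (\<sigma>\<^sub>2 - \<sigma>\<^sub>1)\<close> (and of \<open>\<rho>\<^sub>s u\<^sub>s (\<sigma>\<^sub>2 - \<sigma>\<^sub>1)\<close>). These facts are collected in the locale
  \<open>two_shock_limit\<close>.

  \<^bold>\<open>Reduction to one dimension.\<close> For \<open>\<psi>\<close> continuous with compact support in \<open>t > 0\<close>, the substitution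
  \<open>x = \<xi> t\<close> and Fubini turn the pairing of a self-similar function \<open>r (x / t)\<close> with \<open>\<psi>\<close> into
  \<open>\<integral> r(\<xi>) m(\<xi>) d\<xi>\<close>, where \<open>m(\<xi>) = \<integral> t \<psi>(t, \<xi> t) dt\<close> is continuous and compactly supported. A delta
  function on the line \<open>x = s t\<close> with weight \<open>k t / sqrt (1 + s\<^sup>2)\<close> pairs with \<open>\<psi>\<close> to \<open>k m(s)\<close>. For a
  two-shock profile the integral contains \<open>\<rho>\<^sub>s\<close> times the integral of \<open>m\<close> from \<open>\<sigma>\<^sub>1\<close> to \<open>\<sigma>\<^sub>2\<close>, and by the
  mean value theorem this tends to \<open>m(\<sigma>)\<close> times the limit of \<open>\<rho>\<^sub>s (\<sigma>\<^sub>2 - \<sigma>\<^sub>1)\<close>; this is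
  \<open>three_states_tendsto_delta\<close>.

  \<^bold>\<open>The weak equations.\<close> For a test function \<open>\<phi>\<close> put \<open>h(\<xi>) = \<integral> \<phi>(t, \<xi> t) dt\<close>. The function \<open>m\<close>
  belonging to \<open>\<phi>\<^sub>x\<close> is \<open>h'\<close>, and the one belonging to \<open>\<phi>\<^sub>t\<close> is \<open>- (\<xi> h)'\<close> (integrate by parts
  along the ray). Step functions therefore pair with \<open>\<phi>\<^sub>x\<close> and \<open>\<phi>\<^sub>t\<close> to multiples of \<open>h(\<sigma>)\<close>, and both
  equations reduce to the Rankine-Hugoniot conditions of the delta shock. The first one fixes the
  weight, and the second one is the quadratic equation \<open>\<sigma>\<^sup>2 [\<rho>] - 2 \<sigma> [\<rho> u] + [\<rho> u\<^sup>2] = 0\<close> (brackets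
  denote right state minus left state), of which the given \<open>\<sigma>\<close> is the root between \<open>u\<^sub>p\<close> and \<open>u\<^sub>m\<close>.
\<close>

section \<open>Velocity jumps across a shock\<close>

text \<open>The square of the velocity jump between the densities \<open>\<rho>\<close> and \<open>r\<close>. It is symmetric in the two,
  so that it serves the backward shock, which has \<open>\<rho>\<close> on its left, and the forward shock, which has
  \<open>\<rho>\<close> on its right.\<close>

definition squared_jump :: "real \<Rightarrow> real \<Rightarrow> real \<Rightarrow> real \<Rightarrow> real \<Rightarrow> real" where
  "squared_jump \<gamma> \<epsilon>\<^sub>1 \<epsilon>\<^sub>2 \<rho> r =
     \<epsilon>\<^sub>2 * (r - \<rho>) * (r powr \<gamma> - \<rho> powr \<gamma>) / (\<gamma> * (\<rho> * r - \<epsilon>\<^sub>1 * (\<rho> + r)))"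

text \<open>From \<open>\<epsilon> \<le> \<rho> / 4\<close> and \<open>\<rho> + r \<le> 2 r\<close> the perturbation takes away at most half of \<open>\<rho> r\<close>. The bound
  that remains is uniform in \<open>r\<close>.\<close>

lemma jump_denominator_lower_bound:
  fixes \<epsilon> r \<rho> :: real
  assumes "0 < \<rho>" "\<rho> < r" "0 < \<epsilon>" "4 * \<epsilon> < \<rho>"
  shows "\<rho>\<^sup>2 / 2 \<le> \<rho> * r - \<epsilon> * (\<rho> + r)"
proof -
  have "\<epsilon> * (\<rho> + r) \<le> \<rho> / 4 * (2 * r)"
    using assms by (intro mult_mono) auto
  moreover have "\<rho> * \<rho> \<le> \<rho> * r" using assms by simp
  ultimately show ?thesis by (simp add: power2_eq_square field_simps)
qed

lemma squared_jump_nonneg: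
  assumes "1 < \<gamma>" "0 < \<rho>" "\<rho> < r" "0 < \<epsilon>\<^sub>1" "4 * \<epsilon>\<^sub>1 < \<rho>" "0 < \<epsilon>\<^sub>2"
  shows "0 \<le> squared_jump \<gamma> \<epsilon>\<^sub>1 \<epsilon>\<^sub>2 \<rho> r"
proof -
  have "0 \<le> \<rho>\<^sup>2 / 2" by simp
  also have "\<dots> \<le> \<rho> * r - \<epsilon>\<^sub>1 * (\<rho> + r)"
    using assms by (intro jump_denominator_lower_bound) auto
  finally show ?thesis
    unfolding squared_jump_def using assms
    by (intro divide_nonneg_nonneg mult_nonneg_nonneg) (auto intro!: powr_mono2)
qed

text \<open>The bound is linear in \<open>\<epsilon>\<^sub>2\<close> for fixed \<open>K\<close>: shocks whose densities stay bounded become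
  arbitrarily weak as the pressure vanishes.\<close>

lemma squared_jump_le:
  fixes \<gamma> \<epsilon>\<^sub>1 \<epsilon>\<^sub>2 r \<rho> K :: real
  assumes "1 < \<gamma>" "0 < \<rho>" "\<rho> < r" "r \<le> K" "0 < \<epsilon>\<^sub>1" "4 * \<epsilon>\<^sub>1 < \<rho>" "0 < \<epsilon>\<^sub>2"
  shows "squared_jump \<gamma> \<epsilon>\<^sub>1 \<epsilon>\<^sub>2 \<rho> r \<le> \<epsilon>\<^sub>2 * (K * K powr \<gamma> / (\<gamma> * (\<rho>\<^sup>2 / 2)))"
proof -
  note gap = jump_denominator_lower_bound[OF assms(2,3,5,6)]
  have pw: "\<rho> powr \<gamma> \<le> r powr \<gamma>" "r powr \<gamma> \<le> K powr \<gamma>" "0 \<le> \<rho> powr \<gamma>"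
    using assms by (auto intro!: powr_mono2)
  then have diff: "r powr \<gamma> - \<rho> powr \<gamma> \<le> K powr \<gamma>" "0 \<le> r powr \<gamma> - \<rho> powr \<gamma>"
    by linarith+
  have "\<epsilon>\<^sub>2 * (r - \<rho>) * (r powr \<gamma> - \<rho> powr \<gamma>) \<le> \<epsilon>\<^sub>2 * K * K powr \<gamma>"
    using assms diff by (intro mult_mono mult_nonneg_nonneg) auto
  moreover have "\<gamma> * (\<rho>\<^sup>2 / 2) \<le> \<gamma> * (\<rho> * r - \<epsilon>\<^sub>1 * (\<rho> + r))"
    using assms gap by (intro mult_left_mono) auto
  moreover have "0 < \<gamma> * (\<rho>\<^sup>2 / 2)" using assms by simp
  ultimately have "\<epsilon>\<^sub>2 * (r - \<rho>) * (r powr \<gamma> - \<rho> powr \<gamma>) / (\<gamma> * (\<rho> * r - \<epsilon>\<^sub>1 * (\<rho> + r)))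
      \<le> \<epsilon>\<^sub>2 * K * K powr \<gamma> / (\<gamma> * (\<rho>\<^sup>2 / 2))"
    using assms by (intro frac_le) auto
  then show ?thesis unfolding squared_jump_def by (simp add: mult.assoc)
qed

text \<open>The part of the squared jump that still depends on the outer density once the common factor
  \<open>\<epsilon>\<^sub>2 * r powr \<gamma> / \<gamma>\<close> has been split off. As \<open>\<epsilon>\<^sub>2\<close> vanishes while \<open>r\<close> grows, the limit of
  that factor cannot be read off, but the factor cancels when the two jumps are compared.\<close>

definition reduced_jump :: "real \<Rightarrow> real \<Rightarrow> real \<Rightarrow> real \<Rightarrow> real" where
  "reduced_jump \<gamma> \<epsilon> \<rho> r = (1 - \<rho> / r) * (1 - (\<rho> / r) powr \<gamma>) / (\<rho> - \<epsilon> * (\<rho> / r + 1))"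

lemma squared_jump_factorisation:
  fixes \<gamma> \<epsilon>\<^sub>1 \<epsilon>\<^sub>2 r \<rho> :: real
  assumes "0 < \<rho>" "\<rho> < r"
  shows "squared_jump \<gamma> \<epsilon>\<^sub>1 \<epsilon>\<^sub>2 \<rho> r = \<epsilon>\<^sub>2 * r powr \<gamma> / \<gamma> * reduced_jump \<gamma> \<epsilon>\<^sub>1 \<rho> r"
proof -
  have r: "0 < r" using assms by simp
  have 1: "r - \<rho> = r * (1 - \<rho> / r)" using r by (simp add: field_simps)
  have 2: "r powr \<gamma> - \<rho> powr \<gamma> = r powr \<gamma> * (1 - (\<rho> / r) powr \<gamma>)"
    using assms r by (simp add: powr_divide field_simps)
  have 3: "\<rho> * r - \<epsilon>\<^sub>1 * (\<rho> + r) = r * (\<rho> - \<epsilon>\<^sub>1 * (\<rho> / r + 1))"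
    using r by (simp add: field_simps)
  have "\<epsilon>\<^sub>2 * (r * A) * (p * B) / (\<gamma> * (r * C)) = \<epsilon>\<^sub>2 * p / \<gamma> * (A * B / C)" for A B C p :: real
    using r by simp
  then show ?thesis unfolding squared_jump_def 1 2 3 reduced_jump_def .
qed

lemma tendsto_reduced_jump:
  fixes e r :: "'i \<Rightarrow> real"
  assumes "1 < \<gamma>" "0 < \<rho>" "(e \<longlongrightarrow> 0) F" "filterlim r at_top F"
  shows "((\<lambda>i. reduced_jump \<gamma> (e i) \<rho> (r i)) \<longlongrightarrow> 1 / \<rho>) F"
proof -
  have 0: "((\<lambda>i. \<rho> / r i) \<longlongrightarrow> 0) F"
    by (rule real_tendsto_divide_at_top[OF tendsto_const assms(4)])
  have "eventually (\<lambda>i. 0 \<le> \<rho> / r i) F"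
    using assms(4)[unfolded filterlim_at_top, rule_format, of 1]
    by eventually_elim (use assms in auto)
  then have 1: "((\<lambda>i. (\<rho> / r i) powr \<gamma>) \<longlongrightarrow> 0 powr \<gamma>) F"
    using 0 assms(1) by (intro tendsto_powr') auto
  have "((\<lambda>i. reduced_jump \<gamma> (e i) \<rho> (r i)) \<longlongrightarrow>
        (1 - 0) * (1 - 0 powr \<gamma>) / (\<rho> - 0 * (0 + 1))) F"
    unfolding reduced_jump_def by (intro tendsto_intros 0 1 assms(3)) (use assms in auto)
  then show ?thesis by simp
qed

section \<open>The intermediate state in the vanishing pressure limit\<close>

text \<open>The index \<open>i\<close> stands for the pair of parameters; keeping it abstract lets the perturbations
  and the states be functions on the same footing, with all limits along one filter.\<close>

locale two_shock_limit =
  fixes \<gamma> \<rho>\<^sub>m u\<^sub>m \<rho>\<^sub>p u\<^sub>p \<sigma> :: real and e\<^sub>1 e\<^sub>2 r v s\<^sub>1 s\<^sub>2 :: "'i \<Rightarrow> real" and F :: "'i filter"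
  assumes \<gamma>: "1 < \<gamma>" and \<rho>: "0 < \<rho>\<^sub>m" "0 < \<rho>\<^sub>p" and u: "u\<^sub>p < u\<^sub>m"
    and \<sigma>: "\<sigma> = (sqrt \<rho>\<^sub>m * u\<^sub>m + sqrt \<rho>\<^sub>p * u\<^sub>p) / (sqrt \<rho>\<^sub>m + sqrt \<rho>\<^sub>p)"
    and e\<^sub>1: "filterlim e\<^sub>1 (at_right 0) F" and e\<^sub>2: "filterlim e\<^sub>2 (at_right 0) F"
    and bwd: "\<forall>\<^sub>F i in F. backward_shock \<gamma> (e\<^sub>1 i) (e\<^sub>2 i) (s\<^sub>1 i) \<rho>\<^sub>m u\<^sub>m (r i) (v i)"
    and fwd: "\<forall>\<^sub>F i in F. forward_shock \<gamma> (e\<^sub>1 i) (e\<^sub>2 i) (s\<^sub>2 i) (r i) (v i) \<rho>\<^sub>p u\<^sub>p"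
begin

lemma perturbations_vanish: "(e\<^sub>1 \<longlongrightarrow> 0) F" "(e\<^sub>2 \<longlongrightarrow> 0) F"
  using e\<^sub>1 e\<^sub>2 by (auto simp: filterlim_at)

lemma perturbations_pos: "\<forall>\<^sub>F i in F. 0 < e\<^sub>1 i \<and> 0 < e\<^sub>2 i"
  using e\<^sub>1 e\<^sub>2 by (auto simp: filterlim_at eventually_conj_iff)

lemma perturbation_small: "\<forall>\<^sub>F i in F. 4 * e\<^sub>1 i < \<rho>\<^sub>m \<and> 4 * e\<^sub>1 i < \<rho>\<^sub>p"
  using order_tendstoD(2)[OF perturbations_vanish(1), of "min \<rho>\<^sub>m \<rho>\<^sub>p / 4"] \<rho>
  by (auto elim!: eventually_mono)

abbreviation J :: "'i \<Rightarrow> real \<Rightarrow> real" where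
  "J i \<rho> \<equiv> squared_jump \<gamma> (e\<^sub>1 i) (e\<^sub>2 i) \<rho> (r i)"

lemma velocity_jumps:
  "\<forall>\<^sub>F i in F. \<rho>\<^sub>m < r i \<and> \<rho>\<^sub>p < r i \<and> u\<^sub>m - v i = sqrt (J i \<rho>\<^sub>m) \<and> v i - u\<^sub>p = sqrt (J i \<rho>\<^sub>p)"
  using bwd fwd
proof eventually_elim
  case (elim i)
  have *: "e\<^sub>2 i * (\<rho>\<^sub>p - r i) * (\<rho>\<^sub>p powr \<gamma> - r i powr \<gamma>) / (\<gamma> * (r i * \<rho>\<^sub>p - e\<^sub>1 i * (r i + \<rho>\<^sub>p)))
    = J i \<rho>\<^sub>p"
    unfolding squared_jump_def by (simp add: algebra_simps)
  show ?case
    using elim unfolding backward_shock_def forward_shock_def shock_def *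
    by (auto simp: squared_jump_def)
qed

lemma total_velocity_jump: "\<forall>\<^sub>F i in F. sqrt (J i \<rho>\<^sub>m) + sqrt (J i \<rho>\<^sub>p) = u\<^sub>m - u\<^sub>p"
  using velocity_jumps by eventually_elim auto

text \<open>While \<open>r i < K\<close>, both jumps are bounded by multiples of \<open>sqrt (e\<^sub>2 i)\<close> and cannot add up to
  the positive number \<open>u\<^sub>m - u\<^sub>p\<close>.\<close>

lemma intermediate_density_at_top: "filterlim r at_top F"
  unfolding filterlim_at_top
proof
  fix K :: real
  define B where "B \<rho> = K * K powr \<gamma> / (\<gamma> * (\<rho>\<^sup>2 / 2))" for \<rho>
  have "((\<lambda>i. sqrt (e\<^sub>2 i * B \<rho>\<^sub>m) + sqrt (e\<^sub>2 i * B \<rho>\<^sub>p)) \<longlongrightarrow> sqrt (0 * B \<rho>\<^sub>m) + sqrt (0 * B \<rho>\<^sub>p)) F"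
    by (intro tendsto_intros perturbations_vanish)
  then have "\<forall>\<^sub>F i in F. sqrt (e\<^sub>2 i * B \<rho>\<^sub>m) + sqrt (e\<^sub>2 i * B \<rho>\<^sub>p) < u\<^sub>m - u\<^sub>p"
    using u by (intro order_tendstoD(2)) auto
  then show "\<forall>\<^sub>F i in F. K \<le> r i"
    using total_velocity_jump velocity_jumps perturbations_pos perturbation_small
  proof eventually_elim
    case (elim i)
    show "K \<le> r i"
    proof (rule ccontr)
      assume "\<not> K \<le> r i"
      then have "r i \<le> K" by simp
      then have "J i \<rho>\<^sub>m \<le> e\<^sub>2 i * B \<rho>\<^sub>m" "J i \<rho>\<^sub>p \<le> e\<^sub>2 i * B \<rho>\<^sub>p"
        unfolding B_def using elim \<gamma> \<rho> by (blast intro: squared_jump_le)+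
      then have "sqrt (J i \<rho>\<^sub>m) + sqrt (J i \<rho>\<^sub>p) \<le> sqrt (e\<^sub>2 i * B \<rho>\<^sub>m) + sqrt (e\<^sub>2 i * B \<rho>\<^sub>p)"
        by (intro add_mono real_sqrt_le_mono)
      with elim show False by linarith
    qed
  qed
qed

text \<open>The two jumps are in the ratio of the square roots \<open>c \<rho>\<^sub>m\<close> and \<open>c \<rho>\<^sub>p\<close> of the reduced jumps,
  and their sum is known; the unknown factor \<open>p\<close> drops out.\<close>

lemma intermediate_velocity_tendsto: "(v \<longlongrightarrow> \<sigma>) F"
proof -
  define c where "c \<rho> i = sqrt (reduced_jump \<gamma> (e\<^sub>1 i) \<rho> (r i))" for \<rho> i
  have c: "(c \<rho> \<longlongrightarrow> 1 / sqrt \<rho>) F" if "0 < \<rho>" for \<rho>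
    using tendsto_real_sqrt[OF tendsto_reduced_jump[OF \<gamma> that perturbations_vanish(1) intermediate_density_at_top]]
    by (simp add: c_def[abs_def] real_sqrt_divide)
  have "((\<lambda>i. u\<^sub>m - (u\<^sub>m - u\<^sub>p) * (c \<rho>\<^sub>m i / (c \<rho>\<^sub>m i + c \<rho>\<^sub>p i))) \<longlongrightarrow>
     u\<^sub>m - (u\<^sub>m - u\<^sub>p) * (1 / sqrt \<rho>\<^sub>m / (1 / sqrt \<rho>\<^sub>m + 1 / sqrt \<rho>\<^sub>p))) F"
    using \<rho> by (intro tendsto_intros c) (auto simp: add_pos_pos less_imp_neq[symmetric])
  also have "u\<^sub>m - (u\<^sub>m - u\<^sub>p) * (1 / sqrt \<rho>\<^sub>m / (1 / sqrt \<rho>\<^sub>m + 1 / sqrt \<rho>\<^sub>p)) = \<sigma>"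
  proof -
    have "0 < sqrt \<rho>\<^sub>m" "0 < sqrt \<rho>\<^sub>p" using \<rho> by auto
    then have pos: "sqrt \<rho>\<^sub>m \<noteq> 0" "sqrt \<rho>\<^sub>p \<noteq> 0" "sqrt \<rho>\<^sub>m + sqrt \<rho>\<^sub>p \<noteq> 0" by linarith+
    have "1 / sqrt \<rho>\<^sub>m / (1 / sqrt \<rho>\<^sub>m + 1 / sqrt \<rho>\<^sub>p) = sqrt \<rho>\<^sub>p / (sqrt \<rho>\<^sub>m + sqrt \<rho>\<^sub>p)"
      using pos by (simp add: field_simps)
    moreover have "u\<^sub>m - (u\<^sub>m - u\<^sub>p) * (q / (p + q)) = (p * u\<^sub>m + q * u\<^sub>p) / (p + q)"
      if "p + q \<noteq> 0" for p q :: real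
      using that by (simp add: field_simps)
    ultimately show ?thesis unfolding \<sigma> using pos(3) by metis
  qed
  finally have lim: "((\<lambda>i. u\<^sub>m - (u\<^sub>m - u\<^sub>p) * (c \<rho>\<^sub>m i / (c \<rho>\<^sub>m i + c \<rho>\<^sub>p i))) \<longlongrightarrow> \<sigma>) F" .
  have "\<forall>\<^sub>F i in F. u\<^sub>m - (u\<^sub>m - u\<^sub>p) * (c \<rho>\<^sub>m i / (c \<rho>\<^sub>m i + c \<rho>\<^sub>p i)) = v i"
    using total_velocity_jump velocity_jumps
  proof eventually_elim
    case (elim i)
    define p where "p = sqrt (e\<^sub>2 i * r i powr \<gamma> / \<gamma>)"
    have J': "sqrt (J i \<rho>\<^sub>m) = p * c \<rho>\<^sub>m i" "sqrt (J i \<rho>\<^sub>p) = p * c \<rho>\<^sub>p i"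
      unfolding p_def c_def using elim \<rho>
      by (simp_all add: squared_jump_factorisation real_sqrt_mult[symmetric])
    then have d: "p * (c \<rho>\<^sub>m i + c \<rho>\<^sub>p i) = u\<^sub>m - u\<^sub>p"
      using elim by (simp add: algebra_simps)
    then have "c \<rho>\<^sub>m i + c \<rho>\<^sub>p i \<noteq> 0" using u by auto
    then have "(u\<^sub>m - u\<^sub>p) * (c \<rho>\<^sub>m i / (c \<rho>\<^sub>m i + c \<rho>\<^sub>p i)) = p * c \<rho>\<^sub>m i"
      unfolding d[symmetric] by simp
    then show ?case using elim J' by simp
  qed
  with lim show ?thesis
    by (rule Lim_transform_eventually)
qed

text \<open>Solving the mass relations for the speeds exhibits the distance to the intermediate velocity,
  including its sign.\<close>

lemma shock_speeds_eq:
  "\<forall>\<^sub>F i in F. s\<^sub>1 i = v i + (\<rho>\<^sub>m - 2 * e\<^sub>1 i) * (v i - u\<^sub>m) / (r i - \<rho>\<^sub>m)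
              \<and> s\<^sub>2 i = v i + (\<rho>\<^sub>p - 2 * e\<^sub>1 i) * (v i - u\<^sub>p) / (r i - \<rho>\<^sub>p)"
  using bwd fwd
proof eventually_elim
  case (elim i)
  have "s\<^sub>1 i * (r i - \<rho>\<^sub>m) = (r i - 2 * e\<^sub>1 i) * v i - (\<rho>\<^sub>m - 2 * e\<^sub>1 i) * u\<^sub>m"
    "s\<^sub>2 i * (\<rho>\<^sub>p - r i) = (\<rho>\<^sub>p - 2 * e\<^sub>1 i) * u\<^sub>p - (r i - 2 * e\<^sub>1 i) * v i"
    "\<rho>\<^sub>m < r i" "\<rho>\<^sub>p < r i"
    using elim by (auto simp: backward_shock_def forward_shock_def shock_def)
  then show ?case by (simp add: field_simps)
qed

lemma shock_speeds_tendsto: "(s\<^sub>1 \<longlongrightarrow> \<sigma>) F" "(s\<^sub>2 \<longlongrightarrow> \<sigma>) F"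
proof -
  have gap: "((\<lambda>i. (a - 2 * e\<^sub>1 i) * (v i - b) / (r i - a)) \<longlongrightarrow> 0) F" for a b
  proof (rule real_tendsto_divide_at_top)
    show "((\<lambda>i. (a - 2 * e\<^sub>1 i) * (v i - b)) \<longlongrightarrow> (a - 2 * 0) * (\<sigma> - b)) F"
      by (intro tendsto_intros intermediate_velocity_tendsto perturbations_vanish)
    show "filterlim (\<lambda>i. r i - a) at_top F"
      using filterlim_tendsto_add_at_top[OF tendsto_const[of "-a"] intermediate_density_at_top] by simp
  qed
  show "(s\<^sub>1 \<longlongrightarrow> \<sigma>) F"
    by (rule Lim_transform_eventually[OF _ eventually_mono[OF shock_speeds_eq]])
      (use tendsto_add[OF intermediate_velocity_tendsto gap] in auto)
  show "(s\<^sub>2 \<longlongrightarrow> \<sigma>) F"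
    by (rule Lim_transform_eventually[OF _ eventually_mono[OF shock_speeds_eq]])
      (use tendsto_add[OF intermediate_velocity_tendsto gap] in auto)
qed

text \<open>The velocity decreases across both shocks, so the two corrections to the intermediate velocity
  have opposite signs.\<close>

lemma shock_speeds_ordered: "\<forall>\<^sub>F i in F. s\<^sub>1 i \<le> s\<^sub>2 i"
  using shock_speeds_eq velocity_jumps perturbations_pos perturbation_small
proof eventually_elim
  case (elim i)
  have "0 \<le> J i \<rho>\<^sub>m" "0 \<le> J i \<rho>\<^sub>p"
    using elim \<rho> \<gamma> by (auto intro: squared_jump_nonneg)
  then have "v i \<le> u\<^sub>m" "u\<^sub>p \<le> v i" using elim by (metis diff_ge_0_iff_ge real_sqrt_ge_zero)+
  then have "(\<rho>\<^sub>m - 2 * e\<^sub>1 i) * (v i - u\<^sub>m) / (r i - \<rho>\<^sub>m) \<le> 0"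
    "0 \<le> (\<rho>\<^sub>p - 2 * e\<^sub>1 i) * (v i - u\<^sub>p) / (r i - \<rho>\<^sub>p)"
    by (intro divide_nonpos_nonneg divide_nonneg_nonneg mult_nonneg_nonpos mult_nonneg_nonneg;
        use elim in linarith)+
  then show ?case using elim by linarith
qed

text \<open>In the sum of the two mass relations the flux of the intermediate state cancels. What is
  left of that state is \<open>r i * (s\<^sub>2 i - s\<^sub>1 i)\<close>, the mass per unit of time that collects between the two
  shocks.\<close>

lemma intermediate_mass_tendsto:
  "((\<lambda>i. r i * (s\<^sub>2 i - s\<^sub>1 i)) \<longlongrightarrow> \<sigma> * (\<rho>\<^sub>p - \<rho>\<^sub>m) - (\<rho>\<^sub>p * u\<^sub>p - \<rho>\<^sub>m * u\<^sub>m)) F"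
proof -
  have "((\<lambda>i. s\<^sub>2 i * \<rho>\<^sub>p - s\<^sub>1 i * \<rho>\<^sub>m - ((\<rho>\<^sub>p - 2 * e\<^sub>1 i) * u\<^sub>p - (\<rho>\<^sub>m - 2 * e\<^sub>1 i) * u\<^sub>m)) \<longlongrightarrow>
      \<sigma> * \<rho>\<^sub>p - \<sigma> * \<rho>\<^sub>m - ((\<rho>\<^sub>p - 2 * 0) * u\<^sub>p - (\<rho>\<^sub>m - 2 * 0) * u\<^sub>m)) F"
    by (intro tendsto_intros shock_speeds_tendsto perturbations_vanish)
  moreover have "\<forall>\<^sub>F i in F. s\<^sub>2 i * \<rho>\<^sub>p - s\<^sub>1 i * \<rho>\<^sub>m - ((\<rho>\<^sub>p - 2 * e\<^sub>1 i) * u\<^sub>p - (\<rho>\<^sub>m - 2 * e\<^sub>1 i) * u\<^sub>m)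
      = r i * (s\<^sub>2 i - s\<^sub>1 i)"
    using bwd fwd
    by eventually_elim (auto simp: backward_shock_def forward_shock_def shock_def algebra_simps)
  ultimately show ?thesis
    by (auto simp: algebra_simps intro: Lim_transform_eventually)
qed

text \<open>In the momentum relations the pressure of the intermediate state cancels as well, although it
  does not vanish in the limit.\<close>

lemma intermediate_momentum_tendsto:
  "((\<lambda>i. r i * v i * (s\<^sub>2 i - s\<^sub>1 i)) \<longlongrightarrow>
     \<sigma> * (\<rho>\<^sub>p * u\<^sub>p - \<rho>\<^sub>m * u\<^sub>m) - (\<rho>\<^sub>p * u\<^sub>p\<^sup>2 - \<rho>\<^sub>m * u\<^sub>m\<^sup>2)) F"
proof -
  have "((\<lambda>i. s\<^sub>2 i * (\<rho>\<^sub>p * u\<^sub>p) - s\<^sub>1 i * (\<rho>\<^sub>m * u\<^sub>m)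
        - ((\<rho>\<^sub>p - e\<^sub>1 i) * u\<^sub>p\<^sup>2 - (\<rho>\<^sub>m - e\<^sub>1 i) * u\<^sub>m\<^sup>2 + e\<^sub>2 i / \<gamma> * (\<rho>\<^sub>p powr \<gamma> - \<rho>\<^sub>m powr \<gamma>))) \<longlongrightarrow>
      \<sigma> * (\<rho>\<^sub>p * u\<^sub>p) - \<sigma> * (\<rho>\<^sub>m * u\<^sub>m)
        - ((\<rho>\<^sub>p - 0) * u\<^sub>p\<^sup>2 - (\<rho>\<^sub>m - 0) * u\<^sub>m\<^sup>2 + 0 / \<gamma> * (\<rho>\<^sub>p powr \<gamma> - \<rho>\<^sub>m powr \<gamma>))) F"
    using \<gamma> by (intro tendsto_intros shock_speeds_tendsto perturbations_vanish) auto
  moreover have "\<forall>\<^sub>F i in F. s\<^sub>2 i * (\<rho>\<^sub>p * u\<^sub>p) - s\<^sub>1 i * (\<rho>\<^sub>m * u\<^sub>m)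
        - ((\<rho>\<^sub>p - e\<^sub>1 i) * u\<^sub>p\<^sup>2 - (\<rho>\<^sub>m - e\<^sub>1 i) * u\<^sub>m\<^sup>2 + e\<^sub>2 i / \<gamma> * (\<rho>\<^sub>p powr \<gamma> - \<rho>\<^sub>m powr \<gamma>))
      = r i * v i * (s\<^sub>2 i - s\<^sub>1 i)"
    using bwd fwd
  proof eventually_elim
    case (elim i)
    define P where "P \<rho> = e\<^sub>2 i / \<gamma> * \<rho> powr \<gamma>" for \<rho>
    have "s\<^sub>1 i * (r i * v i - \<rho>\<^sub>m * u\<^sub>m)
        = (r i - e\<^sub>1 i) * (v i)\<^sup>2 - (\<rho>\<^sub>m - e\<^sub>1 i) * u\<^sub>m\<^sup>2 + (P (r i) - P \<rho>\<^sub>m)"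
      "s\<^sub>2 i * (\<rho>\<^sub>p * u\<^sub>p - r i * v i)
        = (\<rho>\<^sub>p - e\<^sub>1 i) * u\<^sub>p\<^sup>2 - (r i - e\<^sub>1 i) * (v i)\<^sup>2 + (P \<rho>\<^sub>p - P (r i))"
      using elim unfolding P_def right_diff_distrib[symmetric]
      by (auto simp: backward_shock_def forward_shock_def shock_def)
    moreover have "e\<^sub>2 i / \<gamma> * (\<rho>\<^sub>p powr \<gamma> - \<rho>\<^sub>m powr \<gamma>) = P \<rho>\<^sub>p - P \<rho>\<^sub>m"
      by (simp add: P_def right_diff_distrib)
    ultimately show ?case by (simp add: algebra_simps)
  qed
  ultimately show ?thesis
    by (auto simp: algebra_simps intro: Lim_transform_eventually)
qed

end

section \<open>Self-similar functions as distributions\<close>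

lemma integrable_bounded_mult:
  fixes f g :: "'a \<Rightarrow> real"
  assumes "integrable M f" "g \<in> borel_measurable M" "\<And>x. \<bar>g x\<bar> \<le> B"
  shows "integrable M (\<lambda>x. g x * f x)"
proof (rule Bochner_Integration.integrable_bound)
  show "integrable M (\<lambda>x. B * f x)" using assms(1) by simp
  show "(\<lambda>x. g x * f x) \<in> borel_measurable M" using assms by measurable
  show "AE x in M. norm (g x * f x) \<le> norm (B * f x)"
    by (auto simp: abs_mult intro!: AE_I2 mult_right_mono order_trans[OF assms(3) abs_ge_self])
qed

lemma integrable_continuous_compact_support:
  fixes f :: "'a::euclidean_space \<Rightarrow> real"
  assumes "continuous_on UNIV f" "compact S" "\<And>x. x \<notin> S \<Longrightarrow> f x = 0"
  shows "integrable lborel f"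
proof -
  have "(\<lambda>x. indicator S x *\<^sub>R f x) = f"
    using assms(3) by (auto simp: indicator_def fun_eq_iff)
  then show ?thesis
    using borel_integrable_compact[OF assms(2) continuous_on_subset[OF assms(1)]] by simp
qed

lemma lborel_integral_eq_interval_integral:
  fixes f :: "real \<Rightarrow> real"
  assumes "continuous_on UNIV f" "\<And>x. x \<notin> {a..b} \<Longrightarrow> f x = 0"
  shows "(LINT x|lborel. f x) = integral {a..b} f"
proof -
  have "integrable lborel f"
    using assms by (intro integrable_continuous_compact_support[of f "{a..b}"]) auto
  then have "(f has_integral (LINT x|lborel. f x)) UNIV"
    by (rule has_integral_integral_lborel)
  moreover have "(f has_integral integral {a..b} f) {a..b}"
    using assms(1) by (intro integrable_integral integrable_continuous_real)
      (auto intro: continuous_on_subset)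
  then have "(f has_integral integral {a..b} f) UNIV"
    by (rule has_integral_on_superset) (use assms(2) in auto)
  ultimately show ?thesis by (rule has_integral_unique)
qed

text \<open>Quantitative form of ``continuous with compact support in \<open>t > 0\<close>''. The bounds on \<open>t\<close> are strict
  so that \<open>\<psi>\<close> vanishes at \<open>t = a\<close> and \<open>t = b\<close>, as needed for integration by parts over \<open>{a..b}\<close>.
  Explicit bounds let a test function and its partial derivatives share one box.\<close>

definition supported_in_box :: "real \<Rightarrow> real \<Rightarrow> real \<Rightarrow> (real \<times> real \<Rightarrow> real) \<Rightarrow> bool" where
  "supported_in_box a b L \<psi> \<longleftrightarrow> continuous_on UNIV \<psi> \<and> 0 < a \<and> a < b \<and> 0 \<le> L \<and>
     (\<forall>t x. \<psi> (t, x) \<noteq> 0 \<longrightarrow> t \<in> {a<..<b} \<and> \<bar>x\<bar> \<le> L)"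

text \<open>The density, in the similarity variable \<open>\<xi> = x / t\<close>, of the measure \<open>\<psi> dx dt\<close>; the factor \<open>t\<close> is the
  Jacobian of \<open>x = \<xi> t\<close>.\<close>

definition ray_moment :: "(real \<times> real \<Rightarrow> real) \<Rightarrow> real \<Rightarrow> real" where
  "ray_moment \<psi> \<xi> = (LINT t|lborel. t * \<psi> (t, \<xi> * t))"

lemma supported_in_box_along_ray:
  assumes "supported_in_box a b L \<psi>" "\<psi> (t, \<xi> * t) \<noteq> 0"
  shows "t \<in> {a<..<b}" "\<xi> \<in> {- (L / a)..L / a}"
proof -
  have *: "0 < a" "t \<in> {a<..<b}" "\<bar>\<xi> * t\<bar> \<le> L"
    using assms by (auto simp: supported_in_box_def)
  then have "\<bar>\<xi>\<bar> * a \<le> \<bar>\<xi>\<bar> * t" by (intro mult_left_mono) auto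
  also have "\<dots> \<le> L" using * by (simp add: abs_mult)
  finally have "\<bar>\<xi>\<bar> \<le> L / a" using * by (simp add: field_simps)
  with * show "t \<in> {a<..<b}" "\<xi> \<in> {- (L / a)..L / a}" by auto
qed

lemma supported_in_box_continuous_along_rays:
  assumes "supported_in_box a b L \<psi>"
  shows "continuous_on UNIV (\<lambda>(t, \<xi>). \<psi> (t, \<xi> * t))"
    and "continuous_on UNIV (\<lambda>t. \<psi> (t, \<xi> * t))"
  using assms by (auto simp: supported_in_box_def split_beta intro!: continuous_on_compose2[of UNIV \<psi>] continuous_intros)

lemma ray_moment_eq:
  assumes "supported_in_box a b L \<psi>"
  shows "ray_moment \<psi> \<xi> = integral {a..b} (\<lambda>t. t * \<psi> (t, \<xi> * t))"
  unfolding ray_moment_def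
proof (rule lborel_integral_eq_interval_integral)
  show "continuous_on UNIV (\<lambda>t. t * \<psi> (t, \<xi> * t))"
    by (intro continuous_intros supported_in_box_continuous_along_rays[OF assms])
  show "t * \<psi> (t, \<xi> * t) = 0" if "t \<notin> {a..b}" for t
    using that supported_in_box_along_ray(1)[OF assms, of t \<xi>] by auto
qed

lemma continuous_ray_moment:
  assumes "supported_in_box a b L \<psi>"
  shows "continuous_on UNIV (ray_moment \<psi>)"
proof -
  have "continuous_on UNIV (\<lambda>\<xi>. integral (cbox a b) (\<lambda>t. t * \<psi> (t, \<xi> * t)))"
    using assms by (intro integral_continuous_on_param)
      (auto simp: supported_in_box_def split_beta intro!: continuous_intros continuous_on_compose2[of UNIV \<psi>])
  then show ?thesis using ray_moment_eq[OF assms] by (simp add: fun_eq_iff[symmetric] ext)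
qed

lemma ray_moment_zero:
  assumes "supported_in_box a b L \<psi>" "\<xi> \<notin> {- (L / a)..L / a}"
  shows "ray_moment \<psi> \<xi> = 0"
proof -
  have "\<psi> (t, \<xi> * t) = 0" for t using supported_in_box_along_ray(2)[OF assms(1)] assms(2) by blast
  then show ?thesis by (simp add: ray_moment_def)
qed

lemma integrable_ray_moment:
  assumes "supported_in_box a b L \<psi>"
  shows "integrable lborel (ray_moment \<psi>)"
  using assms by (intro integrable_continuous_compact_support[of _ "{- (L / a)..L / a}"]
      continuous_ray_moment ray_moment_zero) auto

text \<open>Fubini, the substitution \<open>x = \<xi> t\<close> in the inner integral, and Fubini again. The hypothesis on \<open>g\<close>
  is restricted to \<open>0 < t\<close> so that it covers both \<open>r (x / t)\<close> and the step functions, which compare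
  \<open>x\<close> with \<open>s * t\<close>.\<close>

lemma regular_distr_self_similar:
  assumes \<psi>: "supported_in_box a b L \<psi>" and r [measurable]: "r \<in> borel_measurable borel" and B: "\<And>\<xi>. \<bar>r \<xi>\<bar> \<le> B"
    and g: "\<And>t x. 0 < t \<Longrightarrow> g (t, x) = r (x / t)"
  shows "regular_distr g \<psi> = (LINT \<xi>|lborel. r \<xi> * ray_moment \<psi> \<xi>)"
proof -
  have pos: "0 < t" if "\<psi> (t, x) \<noteq> 0" for t x
    using \<psi> that by (force simp: supported_in_box_def)
  have [measurable]: "\<psi> \<in> borel_measurable borel"
    using \<psi> by (auto simp: supported_in_box_def intro: borel_measurable_continuous_onI)
  have "integrable lborel \<psi>"
    using \<psi> by (intro integrable_continuous_compact_support[of _ "{a..b} \<times> {-L..L}"] compact_Times)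
      (force simp: supported_in_box_def)+
  moreover have "(\<lambda>p. r (snd p / fst p)) \<in> borel_measurable (lborel :: (real \<times> real) measure)"
    unfolding lborel_prod[symmetric] by measurable
  ultimately have int1: "integrable (lborel \<Otimes>\<^sub>M lborel) (\<lambda>(t, x). r (x / t) * \<psi> (t, x))"
    using integrable_bounded_mult[of lborel \<psi> "\<lambda>p. r (snd p / fst p)" B] B
    by (simp add: lborel_prod split_beta')

  have "integrable lborel (\<lambda>(t, \<xi>). t * \<psi> (t, \<xi> * t))"
  proof (rule integrable_continuous_compact_support)
    show "continuous_on UNIV (\<lambda>(t, \<xi>). t * \<psi> (t, \<xi> * t))"
      using continuous_on_mult[OF continuous_on_fst[OF continuous_on_id] supported_in_box_continuous_along_rays(1)[OF \<psi>]]
      by (simp add: split_beta)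
    show "compact ({a..b} \<times> {- (L / a)..L / a})" by (intro compact_Times compact_Icc)
    show "(case p of (t, \<xi>) \<Rightarrow> t * \<psi> (t, \<xi> * t)) = 0" if "p \<notin> {a..b} \<times> {- (L / a)..L / a}" for p
      using that supported_in_box_along_ray[OF \<psi>, of "fst p" "snd p"]
      by (cases "\<psi> (fst p, snd p * fst p) = 0") (auto simp: split_beta mem_Times_iff)
  qed
  moreover have "(\<lambda>p. r (snd p)) \<in> borel_measurable (lborel :: (real \<times> real) measure)"
    unfolding lborel_prod[symmetric] by measurable
  ultimately have int2: "integrable (lborel \<Otimes>\<^sub>M lborel) (\<lambda>(t, \<xi>). r \<xi> * (t * \<psi> (t, \<xi> * t)))"
    using integrable_bounded_mult[of lborel "\<lambda>(t, \<xi>). t * \<psi> (t, \<xi> * t)" "\<lambda>p. r (snd p)" B] B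
    by (simp add: lborel_prod split_beta')

  have "regular_distr g \<psi> = (LINT p|lborel. r (snd p / fst p) * \<psi> p)"
    unfolding regular_distr_def set_lebesgue_integral_def
    by (intro Bochner_Integration.integral_cong)
      (auto simp: half_plane_def indicator_def g intro: pos)
  also have "\<dots> = (LINT t|lborel. LINT x|lborel. r (x / t) * \<psi> (t, x))"
    using lborel_pair.integral_fst[OF int1] by (simp add: lborel_prod split_beta')
  also have "\<dots> = (LINT t|lborel. LINT \<xi>|lborel. r \<xi> * (t * \<psi> (t, \<xi> * t)))"
  proof (rule Bochner_Integration.integral_cong[OF refl])
    fix t :: real
    show "(LINT x|lborel. r (x / t) * \<psi> (t, x)) = (LINT \<xi>|lborel. r \<xi> * (t * \<psi> (t, \<xi> * t)))"
    proof (cases "0 < t")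
      case True
      have "(LINT x|lborel. r (x / t) * \<psi> (t, x)) = \<bar>t\<bar> *\<^sub>R (LINT \<xi>|lborel. r ((0 + t * \<xi>) / t) * \<psi> (t, 0 + t * \<xi>))"
        using True by (intro lborel_integral_real_affine) auto
      also have "\<dots> = (LINT \<xi>|lborel. t * (r \<xi> * \<psi> (t, \<xi> * t)))"
        using True by (simp add: mult.commute)
      finally show ?thesis by (simp add: algebra_simps)
    next
      case False
      then have "\<psi> (t, x) = 0" for x using pos by blast
      then show ?thesis by simp
    qed
  qed
  also have "\<dots> = (LINT \<xi>|lborel. LINT t|lborel. r \<xi> * (t * \<psi> (t, \<xi> * t)))"
    using lborel_pair.Fubini_integral[OF int2] by simp
  finally show ?thesis by (simp add: ray_moment_def)
qed

text \<open>Weights proportional to \<open>t / sqrt (1 + s\<^sup>2)\<close> turn arc length along the line into the measure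
  \<open>t dt\<close> of the ray moment.\<close>

lemma delta_distr_linear_weight:
  assumes "supported_in_box a b L \<psi>"
  shows "delta_distr s (\<lambda>t. t / sqrt (1 + s\<^sup>2) * k) \<psi> = k * ray_moment \<psi> s"
proof -
  have "0 < 1 + s\<^sup>2" by (simp add: add_pos_nonneg)
  then have "delta_distr s (\<lambda>t. t / sqrt (1 + s\<^sup>2) * k) \<psi> = (LINT t|lborel. k * (t * \<psi> (t, s * t)))"
    unfolding delta_distr_def set_lebesgue_integral_def
    using assms by (intro Bochner_Integration.integral_cong)
      (force simp: indicator_def supported_in_box_def)+
  then show ?thesis by (simp add: ray_moment_def)
qed

text \<open>The values at \<open>s\<^sub>1\<close> and \<open>s\<^sub>2\<close> are left open, as they are for the two-shock solution. Both
  \<open>\<rho>\<close> and \<open>\<rho> u\<close> of that solution have this form, and so does a single step, with \<open>s\<^sub>1 = s\<^sub>2\<close>.\<close>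

definition three_states :: "real \<Rightarrow> real \<Rightarrow> real \<Rightarrow> real \<Rightarrow> real \<Rightarrow> (real \<Rightarrow> real) \<Rightarrow> bool" where
  "three_states s\<^sub>1 s\<^sub>2 a m b r \<longleftrightarrow> s\<^sub>1 \<le> s\<^sub>2 \<and>
     (\<forall>\<xi>. (\<xi> < s\<^sub>1 \<longrightarrow> r \<xi> = a) \<and> (s\<^sub>1 < \<xi> \<and> \<xi> < s\<^sub>2 \<longrightarrow> r \<xi> = m) \<and> (s\<^sub>2 < \<xi> \<longrightarrow> r \<xi> = b))"

lemma three_states_measurable:
  assumes "three_states s\<^sub>1 s\<^sub>2 a m b r"
  shows "r \<in> borel_measurable borel"
proof -
  have "r = (\<lambda>\<xi>. if \<xi> < s\<^sub>1 then a else if \<xi> = s\<^sub>1 then r s\<^sub>1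
                 else if \<xi> < s\<^sub>2 then m else if \<xi> = s\<^sub>2 then r s\<^sub>2 else b)" (is "_ = ?r")
    using assms by (auto simp: three_states_def fun_eq_iff)
  moreover have "?r \<in> borel_measurable borel" by measurable
  ultimately show ?thesis by simp
qed

lemma three_states_bounded:
  assumes "three_states s\<^sub>1 s\<^sub>2 a m b r"
  shows "\<bar>r \<xi>\<bar> \<le> Max {\<bar>a\<bar>, \<bar>r s\<^sub>1\<bar>, \<bar>m\<bar>, \<bar>r s\<^sub>2\<bar>, \<bar>b\<bar>}"
proof -
  have "r \<xi> \<in> {a, r s\<^sub>1, m, r s\<^sub>2, b}"
    using assms unfolding three_states_def by (metis insertI1 insertI2 linorder_neqE)
  then show ?thesis by (intro Max_ge) auto
qed

text \<open>\<open>H\<close> is any antiderivative of \<open>g\<close> on an interval that contains the support of \<open>g\<close> and both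
  jumps; the derivative at the ends of the interval is one-sided, so that the indefinite integral
  of \<open>g\<close> from \<open>-C\<close> qualifies.\<close>

lemma integral_three_states:
  assumes r: "three_states s\<^sub>1 s\<^sub>2 a m b r"
    and int: "integrable lborel g"
    and H: "\<And>\<xi>. \<xi> \<in> {-C..C} \<Longrightarrow> (H has_real_derivative g \<xi>) (at \<xi> within {-C..C})"
    and zero: "\<And>\<xi>. \<xi> \<notin> {-C..C} \<Longrightarrow> g \<xi> = 0"
    and C: "-C \<le> s\<^sub>1" "s\<^sub>2 \<le> C"
  shows "(LINT \<xi>|lborel. r \<xi> * g \<xi>) = a * (H s\<^sub>1 - H (-C)) + m * (H s\<^sub>2 - H s\<^sub>1) + b * (H C - H s\<^sub>2)"
proof -
  have piece: "((\<lambda>\<xi>. r \<xi> * g \<xi>) has_integral c * (H y - H x)) {x..y}"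
    if "-C \<le> x" "x \<le> y" "y \<le> C" "\<And>\<xi>. x < \<xi> \<Longrightarrow> \<xi> < y \<Longrightarrow> r \<xi> = c" for x y c
  proof -
    have "(g has_integral H y - H x) {x..y}"
    proof (rule fundamental_theorem_of_calculus[OF that(2)])
      fix \<xi> assume "\<xi> \<in> {x..y}"
      then have "(H has_real_derivative g \<xi>) (at \<xi> within {x..y})"
        using that by (intro DERIV_subset[OF H]) auto
      then show "(H has_vector_derivative g \<xi>) (at \<xi> within {x..y})"
        by (simp add: has_real_derivative_iff_has_vector_derivative)
    qed
    then have "((\<lambda>\<xi>. c * g \<xi>) has_integral c * (H y - H x)) {x..y}"
      by (rule has_integral_mult_right)
    then show ?thesis
      by (rule has_integral_spike_finite[of "{x, y}", rotated 2]) (use that(4) in auto)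
  qed
  have s: "s\<^sub>1 \<le> s\<^sub>2" using r by (simp add: three_states_def)
  have "((\<lambda>\<xi>. r \<xi> * g \<xi>) has_integral a * (H s\<^sub>1 - H (-C)) + m * (H s\<^sub>2 - H s\<^sub>1)) {-C..s\<^sub>2}"
    using r C s by (intro has_integral_combine[OF C(1) s piece piece]) (auto simp: three_states_def)
  then have "((\<lambda>\<xi>. r \<xi> * g \<xi>) has_integral
      a * (H s\<^sub>1 - H (-C)) + m * (H s\<^sub>2 - H s\<^sub>1) + b * (H C - H s\<^sub>2)) {-C..C}"
    by (rule has_integral_combine[rotated 2, OF _ piece])
      (use r C s in \<open>auto simp: three_states_def\<close>)
  then have "((\<lambda>\<xi>. r \<xi> * g \<xi>) has_integral
      a * (H s\<^sub>1 - H (-C)) + m * (H s\<^sub>2 - H s\<^sub>1) + b * (H C - H s\<^sub>2)) UNIV"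
    by (rule has_integral_on_superset) (use zero in auto)
  moreover have "integrable lborel (\<lambda>\<xi>. r \<xi> * g \<xi>)"
    using three_states_measurable[OF r] three_states_bounded[OF r] int
    by (intro integrable_bounded_mult) auto
  ultimately show ?thesis by (intro has_integral_unique[OF has_integral_integral_lborel])
qed

lemma regular_distr_three_states:
  assumes \<psi>: "supported_in_box A B L \<psi>" and r: "three_states s\<^sub>1 s\<^sub>2 a m b r"
    and g: "\<And>t x. 0 < t \<Longrightarrow> g (t, x) = r (x / t)"
    and H: "\<And>\<xi>. \<xi> \<in> {-C..C} \<Longrightarrow> (H has_real_derivative ray_moment \<psi> \<xi>) (at \<xi> within {-C..C})"
    and C: "L / A \<le> C" "-C \<le> s\<^sub>1" "s\<^sub>2 \<le> C"
  shows "regular_distr g \<psi> = a * (H s\<^sub>1 - H (-C)) + m * (H s\<^sub>2 - H s\<^sub>1) + b * (H C - H s\<^sub>2)"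
proof -
  have "regular_distr g \<psi> = (LINT \<xi>|lborel. r \<xi> * ray_moment \<psi> \<xi>)"
    by (rule regular_distr_self_similar[OF \<psi> three_states_measurable[OF r] three_states_bounded[OF r]])
      (rule g)
  also have "\<dots> = a * (H s\<^sub>1 - H (-C)) + m * (H s\<^sub>2 - H s\<^sub>1) + b * (H C - H s\<^sub>2)"
  proof (rule integral_three_states[OF r integrable_ray_moment[OF \<psi>] H _ C(2,3)])
    show "ray_moment \<psi> \<xi> = 0" if "\<xi> \<notin> {-C..C}" for \<xi>
      using that C(1) by (intro ray_moment_zero[OF \<psi>]) auto
  qed
  finally show ?thesis .
qed

lemma step_self_similar:
  "0 < t \<Longrightarrow> step s a b (t, x) = (if x / t < s then a else b)"
  by (simp add: step_def pos_divide_less_eq)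

lemma three_states_step: "three_states s s a 0 b (\<lambda>\<xi>. if \<xi> < s then a else b)"
  by (auto simp: three_states_def)

section \<open>Concentration of a growing middle state\<close>

text \<open>The middle state may blow up, but it is paired with the increment of an antiderivative \<open>H\<close> of the ray
  moment between the two jumps. The mean value theorem writes this increment as
  \<open>(s\<^sub>2 i - s\<^sub>1 i)\<close> times a value of the ray moment at a point \<open>c i\<close> squeezed towards \<open>\<sigma>\<close>.\<close>

lemma three_states_tendsto_delta:
  fixes F :: "'i filter"
  assumes \<psi>: "supported_in_box A B L \<psi>"
    and s: "(s\<^sub>1 \<longlongrightarrow> \<sigma>) F" "(s\<^sub>2 \<longlongrightarrow> \<sigma>) F"
    and r: "\<forall>\<^sub>F i in F. three_states (s\<^sub>1 i) (s\<^sub>2 i) a (m i) b (r i)"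
    and g: "\<And>i t x. 0 < t \<Longrightarrow> g i (t, x) = r i (x / t)"
    and k: "((\<lambda>i. m i * (s\<^sub>2 i - s\<^sub>1 i)) \<longlongrightarrow> k) F"
  shows "((\<lambda>i. regular_distr (g i) \<psi>) \<longlongrightarrow> regular_distr (step \<sigma> a b) \<psi> + k * ray_moment \<psi> \<sigma>) F"
proof -
  have LA: "0 \<le> L / A" using \<psi> by (simp add: supported_in_box_def)
  \<comment> \<open>The interval contains the support of the ray moment and has \<open>\<sigma>\<close> in its interior.\<close>
  define C where "C = L / A + \<bar>\<sigma>\<bar> + 1"
  have C: "L / A \<le> C" "-C < \<sigma>" "\<sigma> < C" using LA by (auto simp: C_def)
  define H where "H x = integral {-C..x} (ray_moment \<psi>)" for x
  have H: "(H has_real_derivative ray_moment \<psi> \<xi>) (at \<xi> within {-C..C})" if "\<xi> \<in> {-C..C}" for \<xi>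
    unfolding H_def using that
    by (intro integral_has_real_derivative continuous_on_subset[OF continuous_ray_moment[OF \<psi>]]) auto
  have Hcont: "continuous_on {-C..C} H"
    using H by (meson DERIV_continuous_on)
  have near: "\<forall>\<^sub>F i in F. -C < s\<^sub>1 i \<and> s\<^sub>1 i < C \<and> -C < s\<^sub>2 i \<and> s\<^sub>2 i < C"
    using order_tendstoD[OF s(1)] order_tendstoD[OF s(2)] C by (simp add: eventually_conj_iff)
  have Hlim: "((\<lambda>i. H (f i)) \<longlongrightarrow> H \<sigma>) F" if "(f \<longlongrightarrow> \<sigma>) F" "\<forall>\<^sub>F i in F. f i \<in> {-C..C}" for f
    using continuous_on_tendsto_compose[OF Hcont that(1) _ that(2)] C by auto
  have in1: "\<forall>\<^sub>F i in F. s\<^sub>1 i \<in> {-C..C}" and in2: "\<forall>\<^sub>F i in F. s\<^sub>2 i \<in> {-C..C}"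
    using near by (auto elim: eventually_mono)
  have "\<exists>c. s\<^sub>1 i \<le> s\<^sub>2 i \<and> s\<^sub>1 i \<in> {-C..C} \<and> s\<^sub>2 i \<in> {-C..C} \<longrightarrow>
      c \<in> {s\<^sub>1 i..s\<^sub>2 i} \<and> H (s\<^sub>2 i) - H (s\<^sub>1 i) = ray_moment \<psi> c * (s\<^sub>2 i - s\<^sub>1 i)" for i
  proof (cases "s\<^sub>1 i \<le> s\<^sub>2 i \<and> s\<^sub>1 i \<in> {-C..C} \<and> s\<^sub>2 i \<in> {-C..C}")
    case True
    have "\<exists>c\<in>{s\<^sub>1 i..s\<^sub>2 i}. H (s\<^sub>2 i) - H (s\<^sub>1 i) = (\<lambda>h. ray_moment \<psi> c * h) (s\<^sub>2 i - s\<^sub>1 i)"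
    proof (rule mvt_very_simple)
      show "(H has_derivative (*) (ray_moment \<psi> x)) (at x within {s\<^sub>1 i..s\<^sub>2 i})"
        if "s\<^sub>1 i \<le> x" "x \<le> s\<^sub>2 i" for x
        using DERIV_subset[OF H, of x "{s\<^sub>1 i..s\<^sub>2 i}"] that True
        by (auto simp: has_field_derivative_def)
    qed (use True in auto)
    then show ?thesis by auto
  qed blast
  then obtain c where c: "s\<^sub>1 i \<le> s\<^sub>2 i \<and> s\<^sub>1 i \<in> {-C..C} \<and> s\<^sub>2 i \<in> {-C..C} \<Longrightarrow>
      c i \<in> {s\<^sub>1 i..s\<^sub>2 i} \<and> H (s\<^sub>2 i) - H (s\<^sub>1 i) = ray_moment \<psi> (c i) * (s\<^sub>2 i - s\<^sub>1 i)" for i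
    by metis
  have mean: "\<forall>\<^sub>F i in F. c i \<in> {s\<^sub>1 i..s\<^sub>2 i} \<and> H (s\<^sub>2 i) - H (s\<^sub>1 i) = ray_moment \<psi> (c i) * (s\<^sub>2 i - s\<^sub>1 i)"
    using r in1 in2 by eventually_elim (rule c, auto simp: three_states_def)
  have "(c \<longlongrightarrow> \<sigma>) F"
    by (rule tendsto_sandwich[OF _ _ s]) (use mean in \<open>auto elim: eventually_mono\<close>)
  then have ray: "((\<lambda>i. ray_moment \<psi> (c i)) \<longlongrightarrow> ray_moment \<psi> \<sigma>) F"
    using continuous_on_tendsto_compose[OF continuous_ray_moment[OF \<psi>]] by auto
  have "((\<lambda>i. a * (H (s\<^sub>1 i) - H (-C)) + m i * (s\<^sub>2 i - s\<^sub>1 i) * ray_moment \<psi> (c i) + b * (H C - H (s\<^sub>2 i)))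
      \<longlongrightarrow> a * (H \<sigma> - H (-C)) + k * ray_moment \<psi> \<sigma> + b * (H C - H \<sigma>)) F"
    by (intro tendsto_intros Hlim s in1 in2 k ray)
  then have "((\<lambda>i. regular_distr (g i) \<psi>) \<longlongrightarrow>
      a * (H \<sigma> - H (-C)) + k * ray_moment \<psi> \<sigma> + b * (H C - H \<sigma>)) F"
  proof (rule Lim_transform_eventually)
    show "\<forall>\<^sub>F i in F. a * (H (s\<^sub>1 i) - H (-C)) + m i * (s\<^sub>2 i - s\<^sub>1 i) * ray_moment \<psi> (c i)
      + b * (H C - H (s\<^sub>2 i)) = regular_distr (g i) \<psi>"
      using mean r near
    proof eventually_elim
      case (elim i)
      have "regular_distr (g i) \<psi> =
          a * (H (s\<^sub>1 i) - H (-C)) + m i * (H (s\<^sub>2 i) - H (s\<^sub>1 i)) + b * (H C - H (s\<^sub>2 i))"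
        by (rule regular_distr_three_states[where H=H and C=C and r="r i", OF \<psi>])
          (use elim g H C in auto)
      then show ?case using elim by simp
    qed
  qed
  moreover have "regular_distr (step \<sigma> a b) \<psi> = a * (H \<sigma> - H (-C)) + b * (H C - H \<sigma>)"
    using regular_distr_three_states[OF \<psi> three_states_step step_self_similar H C(1)] C by simp
  then have "regular_distr (step \<sigma> a b) \<psi> + k * ray_moment \<psi> \<sigma>
      = a * (H \<sigma> - H (-C)) + k * ray_moment \<psi> \<sigma> + b * (H C - H \<sigma>)" by simp
  ultimately show ?thesis by (simp only:)
qed

section \<open>Partial derivatives of test functions along rays\<close>

lemma test_function_has_derivative:
  assumes "test_function \<phi>"
  shows "(\<phi> has_derivative (\<lambda>h. fst h * partial_t \<phi> p + snd h * partial_x \<phi> p)) (at p)"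
proof -
  have "C_k (Suc 0) \<phi>" using assms by (simp add: test_function_def del: C_k.simps)
  then have "\<phi> differentiable (at p)" by (simp del: split_paired_All)
  then obtain D where D: "(\<phi> has_derivative D) (at p)" by (auto simp: differentiable_def)
  obtain t x where p: "p = (t, x)" by fastforce
  have lin: "linear D" using D by (rule has_derivative_linear)
  have scale: "h * D (1, 0) = D (h, 0)" "h * D (0, 1) = D (0, h)" for h
    using linear_scale[OF lin, of h "(1, 0)"] linear_scale[OF lin, of h "(0, 1)"] by simp_all
  have "((\<lambda>\<tau>. \<phi> (\<tau>, x)) has_derivative (\<lambda>h. D (h, 0))) (at t)"
    by (rule has_derivative_compose[where g=\<phi> and f="\<lambda>\<tau>. (\<tau>, x)"])
      (auto intro!: derivative_eq_intros D[unfolded p])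
  then have "((\<lambda>\<tau>. \<phi> (\<tau>, x)) has_real_derivative D (1, 0)) (at t)"
    by (rule has_derivative_imp_has_field_derivative) (rule scale(1))
  then have Dt: "D (1, 0) = partial_t \<phi> p"
    by (simp add: partial_t_def p DERIV_imp_deriv)
  have "((\<lambda>y. \<phi> (t, y)) has_derivative (\<lambda>h. D (0, h))) (at x)"
    by (rule has_derivative_compose[where g=\<phi> and f="\<lambda>y. (t, y)"])
      (auto intro!: derivative_eq_intros D[unfolded p])
  then have "((\<lambda>y. \<phi> (t, y)) has_real_derivative D (0, 1)) (at x)"
    by (rule has_derivative_imp_has_field_derivative) (rule scale(2))
  then have Dx: "D (0, 1) = partial_x \<phi> p"
    by (simp add: partial_x_def p DERIV_imp_deriv)
  have "D h = fst h * partial_t \<phi> p + snd h * partial_x \<phi> p" for h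
  proof -
    have "D h = D ((fst h, 0) + (0, snd h))" by simp
    also have "\<dots> = D (fst h, 0) + D (0, snd h)" by (rule linear_add[OF lin])
    also have "\<dots> = fst h * D (1, 0) + snd h * D (0, 1)" by (simp only: scale)
    finally show ?thesis by (simp only: Dt Dx)
  qed
  then have "D = (\<lambda>h. fst h * partial_t \<phi> p + snd h * partial_x \<phi> p)" by (rule ext)
  with D show ?thesis by (simp only:)
qed

lemma test_function_supported_in_box:
  assumes "test_function \<phi>"
  obtains a b L where "supported_in_box a b L \<phi>" "supported_in_box a b L (partial_t \<phi>)" "supported_in_box a b L (partial_x \<phi>)"
proof -
  define K where "K = closure {p. \<phi> p \<noteq> 0}"
  have K: "compact K" "K \<subseteq> half_plane" using assms by (auto simp: test_function_def K_def)
  have "\<exists>a>0. \<forall>p\<in>K. a < fst p"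
  proof (cases "K = {}")
    case False
    then have "compact (fst ` K)" "fst ` K \<noteq> {}"
      using K(1) by (auto intro!: compact_continuous_image continuous_intros)
    then obtain m where "m \<in> fst ` K" "\<forall>t\<in>fst ` K. m \<le> t"
      using compact_attains_inf by metis
    moreover from this have "0 < m" using K(2) by (auto simp: half_plane_def)
    ultimately have "0 < m / 2" "\<forall>p\<in>K. m / 2 < fst p" by force+
    then show ?thesis by blast
  qed (auto intro: exI[of _ 1])
  then obtain a where a: "0 < a" "\<And>p. p \<in> K \<Longrightarrow> a < fst p" by blast
  obtain N where N: "\<And>p. p \<in> K \<Longrightarrow> norm p \<le> N"
    using compact_imp_bounded[OF K(1)] by (auto simp: bounded_iff)
  define b L where "b = max a N + 1" and "L = max 0 N"
  have boxI: "supported_in_box a b L \<psi>" if "continuous_on UNIV \<psi>" "\<And>p. p \<notin> K \<Longrightarrow> \<psi> p = 0" for \<psi>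
  proof -
    have "t \<in> {a<..<b} \<and> \<bar>x\<bar> \<le> L" if "\<psi> (t, x) \<noteq> 0" for t x
    proof -
      have "(t, x) \<in> K" using \<open>\<And>p. p \<notin> K \<Longrightarrow> \<psi> p = 0\<close> that by blast
      then have "a < t" "norm (t, x) \<le> N" using a(2) N by force+
      moreover have "\<bar>t\<bar> \<le> norm (t, x)" "\<bar>x\<bar> \<le> norm (t, x)"
        using norm_fst_le[of t x] norm_snd_le[of x t] by auto
      ultimately show ?thesis by (auto simp: b_def L_def)
    qed
    then show ?thesis using that(1) a(1) by (auto simp: supported_in_box_def b_def L_def)
  qed
  have cont: "continuous_on UNIV \<phi>" "continuous_on UNIV (partial_t \<phi>)" "continuous_on UNIV (partial_x \<phi>)"
  proof -
    have "C_k 0 \<phi>" "C_k (Suc 0) \<phi>" using assms by (simp_all add: test_function_def del: C_k.simps)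
    then show "continuous_on UNIV \<phi>" "continuous_on UNIV (partial_t \<phi>)" "continuous_on UNIV (partial_x \<phi>)"
      by auto
  qed
  have zero: "\<phi> p = 0" if "p \<notin> K" for p
    using that closure_subset[of "{p. \<phi> p \<noteq> 0}"] by (auto simp: K_def)
  \<comment> \<open>Off the closed set \<open>K\<close> the function vanishes on a neighbourhood, and hence so does its derivative.\<close>
  have derivs: "partial_t \<phi> p = 0 \<and> partial_x \<phi> p = 0" if "p \<notin> K" for p
  proof -
    have "open (- K)" unfolding K_def by (rule open_Compl[OF closed_closure])
    then have "((\<lambda>_. 0) has_derivative (\<lambda>h. fst h * partial_t \<phi> p + snd h * partial_x \<phi> p)) (at p)"
      by (rule has_derivative_transform_within_open[OF test_function_has_derivative[OF assms]])
        (use that zero in auto)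
    then have "(\<lambda>h. fst h * partial_t \<phi> p + snd h * partial_x \<phi> p) = (\<lambda>h. 0)"
      by (rule has_derivative_unique) simp
    from fun_cong[OF this, of "(1, 0)"] fun_cong[OF this, of "(0, 1)"] show ?thesis by simp
  qed
  show thesis by (rule that; rule boxI) (use cont zero derivs in auto)
qed

definition ray_integral :: "(real \<times> real \<Rightarrow> real) \<Rightarrow> real \<Rightarrow> real" where
  "ray_integral \<phi> \<xi> = (LINT t|lborel. \<phi> (t, \<xi> * t))"

lemma ray_integral_eq:
  assumes "supported_in_box a b L \<psi>"
  shows "ray_integral \<psi> \<xi> = integral {a..b} (\<lambda>t. \<psi> (t, \<xi> * t))"
  unfolding ray_integral_def
proof (rule lborel_integral_eq_interval_integral)
  show "\<psi> (t, \<xi> * t) = 0" if "t \<notin> {a..b}" for t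
    using that supported_in_box_along_ray(1)[OF assms, of t \<xi>] by (cases "\<psi> (t, \<xi> * t) = 0") auto
qed (rule supported_in_box_continuous_along_rays[OF assms])

lemma ray_integral_zero:
  assumes "supported_in_box a b L \<psi>" "\<xi> \<notin> {- (L / a)..L / a}"
  shows "ray_integral \<psi> \<xi> = 0"
proof -
  have "\<psi> (t, \<xi> * t) = 0" for t using supported_in_box_along_ray(2)[OF assms(1)] assms(2) by blast
  then show ?thesis by (simp add: ray_integral_def)
qed

text \<open>Differentiation under the integral sign: moving the ray by \<open>d\<xi>\<close> moves its point at time \<open>t\<close> by
  \<open>t d\<xi>\<close>, which produces the factor \<open>t\<close> of the ray moment.\<close>

lemma has_real_derivative_ray_integral:
  assumes \<phi>: "test_function \<phi>" and box: "supported_in_box a b L \<phi>" "supported_in_box a b L (partial_x \<phi>)"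
  shows "(ray_integral \<phi> has_real_derivative ray_moment (partial_x \<phi>) \<xi>) (at \<xi>)"
proof -
  have "((\<lambda>\<xi>. integral (cbox a b) (\<lambda>t. \<phi> (t, \<xi> * t))) has_real_derivative
      integral (cbox a b) (\<lambda>t. t * partial_x \<phi> (t, \<xi> * t))) (at \<xi> within UNIV)"
  proof (rule leibniz_rule_field_derivative)
    fix \<xi> t :: real
    have "((\<lambda>\<xi>. (t, \<xi> * t)) has_derivative (\<lambda>h. (0, h * t))) (at \<xi>)"
      by (auto intro!: derivative_eq_intros)
    from has_derivative_compose[OF this test_function_has_derivative[OF \<phi>]]
    show "((\<lambda>\<xi>. \<phi> (t, \<xi> * t)) has_real_derivative t * partial_x \<phi> (t, \<xi> * t)) (at \<xi> within UNIV)"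
      by (rule has_derivative_imp_has_field_derivative) simp
  next
    fix \<xi> :: real
    show "(\<lambda>t. \<phi> (t, \<xi> * t)) integrable_on cbox a b"
      by (intro integrable_continuous continuous_on_subset[OF supported_in_box_continuous_along_rays(2)[OF box(1)]]) auto
  next
    show "continuous_on (UNIV \<times> cbox a b) (\<lambda>(\<xi>, t). t * partial_x \<phi> (t, \<xi> * t))"
      using box by (auto simp: supported_in_box_def split_beta
          intro!: continuous_intros continuous_on_compose2[of UNIV "partial_x \<phi>"])
  qed auto
  moreover have "ray_integral \<phi> = (\<lambda>\<xi>. integral (cbox a b) (\<lambda>t. \<phi> (t, \<xi> * t)))"
    using ray_integral_eq[OF box(1)] by auto
  ultimately show ?thesis by (simp add: ray_moment_eq[OF box(2)])
qed

text \<open>The left-hand side is the integral along the ray of \<open>t\<close> times the total derivative of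
  \<open>\<phi>(t, \<xi> t)\<close>. Together with the previous lemma it says that the ray moment of \<open>\<phi>\<^sub>t\<close> is the derivative of
  \<open>- \<xi> h(\<xi>)\<close>, where \<open>h\<close> is the ray integral of \<open>\<phi>\<close>.\<close>

lemma ray_moment_by_parts:
  assumes \<phi>: "test_function \<phi>"
    and box: "supported_in_box a b L \<phi>" "supported_in_box a b L (partial_t \<phi>)" "supported_in_box a b L (partial_x \<phi>)"
  shows "ray_moment (partial_t \<phi>) \<xi> + \<xi> * ray_moment (partial_x \<phi>) \<xi> = - ray_integral \<phi> \<xi>"
proof -
  have ab: "a \<le> b" using box(1) by (simp add: supported_in_box_def)
  have ends: "\<phi> (a, \<xi> * a) = 0" "\<phi> (b, \<xi> * b) = 0"
    using supported_in_box_along_ray(1)[OF box(1)] by force+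
  have "((\<lambda>t. \<phi> (t, \<xi> * t) + (t * partial_t \<phi> (t, \<xi> * t) + \<xi> * (t * partial_x \<phi> (t, \<xi> * t))))
      has_integral b * \<phi> (b, \<xi> * b) - a * \<phi> (a, \<xi> * a)) {a..b}"
  proof (rule fundamental_theorem_of_calculus[OF ab])
    fix t
    have "((\<lambda>t. \<phi> (t, \<xi> * t)) has_derivative (\<lambda>h. fst (h, \<xi> * h) * partial_t \<phi> (t, \<xi> * t)
        + snd (h, \<xi> * h) * partial_x \<phi> (t, \<xi> * t))) (at t)"
      by (rule has_derivative_compose[where g=\<phi> and f="\<lambda>t. (t, \<xi> * t)", OF _ test_function_has_derivative[OF \<phi>]])
        (auto intro!: derivative_eq_intros)
    then have "((\<lambda>t. \<phi> (t, \<xi> * t)) has_real_derivative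
        partial_t \<phi> (t, \<xi> * t) + \<xi> * partial_x \<phi> (t, \<xi> * t)) (at t)"
      by (rule has_derivative_imp_has_field_derivative) (simp add: algebra_simps)
    then have "((\<lambda>t. t * \<phi> (t, \<xi> * t)) has_real_derivative
        \<phi> (t, \<xi> * t) + (t * partial_t \<phi> (t, \<xi> * t) + \<xi> * (t * partial_x \<phi> (t, \<xi> * t)))) (at t)"
      by (auto intro!: derivative_eq_intros simp: algebra_simps)
    then show "((\<lambda>t. t * \<phi> (t, \<xi> * t)) has_vector_derivative
        \<phi> (t, \<xi> * t) + (t * partial_t \<phi> (t, \<xi> * t) + \<xi> * (t * partial_x \<phi> (t, \<xi> * t)))) (at t within {a..b})"
      by (simp add: has_real_derivative_iff_has_vector_derivative has_vector_derivative_at_within)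
  qed
  moreover have "((\<lambda>t. \<phi> (t, \<xi> * t) + (t * partial_t \<phi> (t, \<xi> * t) + \<xi> * (t * partial_x \<phi> (t, \<xi> * t))))
      has_integral ray_integral \<phi> \<xi> + (ray_moment (partial_t \<phi>) \<xi> + \<xi> * ray_moment (partial_x \<phi>) \<xi>)) {a..b}"
    unfolding ray_integral_eq[OF box(1)] ray_moment_eq[OF box(2)] ray_moment_eq[OF box(3)]
    by (intro has_integral_add has_integral_mult_right integrable_integral integrable_continuous_real
        continuous_intros continuous_on_subset[OF supported_in_box_continuous_along_rays(2)[OF box(1)]]
        continuous_on_subset[OF supported_in_box_continuous_along_rays(2)[OF box(2)]]
        continuous_on_subset[OF supported_in_box_continuous_along_rays(2)[OF box(3)]]) auto
  ultimately have "b * \<phi> (b, \<xi> * b) - a * \<phi> (a, \<xi> * a) =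
      ray_integral \<phi> \<xi> + (ray_moment (partial_t \<phi>) \<xi> + \<xi> * ray_moment (partial_x \<phi>) \<xi>)"
    by (rule has_integral_unique)
  then show ?thesis using ends by simp
qed

text \<open>The ray moments of \<open>\<phi>\<^sub>x\<close> and \<open>\<phi>\<^sub>t\<close> have the compactly supported antiderivatives \<open>h(\<xi>)\<close> and
  \<open>- \<xi> h(\<xi>)\<close>, so only the jump at \<open>s\<close> contributes.\<close>

lemma regular_distr_step_partials:
  assumes \<phi>: "test_function \<phi>"
  shows "regular_distr (step s a b) (partial_x \<phi>) = (a - b) * ray_integral \<phi> s"
    and "regular_distr (step s a b) (partial_t \<phi>) = - s * (a - b) * ray_integral \<phi> s"
proof -
  obtain A B L where box: "supported_in_box A B L \<phi>" "supported_in_box A B L (partial_t \<phi>)" "supported_in_box A B L (partial_x \<phi>)"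
    by (rule test_function_supported_in_box[OF \<phi>])
  have LA: "0 \<le> L / A" using box(1) by (simp add: supported_in_box_def)
  define C where "C = L / A + \<bar>s\<bar> + 1"
  have C: "L / A \<le> C" "-C \<le> s" "s \<le> C" using LA by (auto simp: C_def)
  have ends: "ray_integral \<phi> C = 0" "ray_integral \<phi> (-C) = 0"
    using LA by (auto intro!: ray_integral_zero[OF box(1)] simp: C_def)
  have dx: "(ray_integral \<phi> has_real_derivative ray_moment (partial_x \<phi>) \<xi>) (at \<xi>)" for \<xi>
    by (rule has_real_derivative_ray_integral[OF \<phi> box(1,3)])
  show "regular_distr (step s a b) (partial_x \<phi>) = (a - b) * ray_integral \<phi> s"
    using regular_distr_three_states[OF box(3) three_states_step step_self_similar
        DERIV_subset[OF dx subset_UNIV] C]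
    by (simp add: ends algebra_simps)
  have dt: "((\<lambda>\<xi>. - \<xi> * ray_integral \<phi> \<xi>) has_real_derivative ray_moment (partial_t \<phi>) \<xi>) (at \<xi>)" for \<xi>
    by (rule DERIV_cong[OF DERIV_mult[OF DERIV_minus[OF DERIV_ident] dx]])
      (use ray_moment_by_parts[OF \<phi> box, of \<xi>] in \<open>simp add: algebra_simps\<close>)
  show "regular_distr (step s a b) (partial_t \<phi>) = - s * (a - b) * ray_integral \<phi> s"
    using regular_distr_three_states[OF box(2) three_states_step step_self_similar
        DERIV_subset[OF dt subset_UNIV] C]
    by (simp add: ends algebra_simps)
qed

section \<open>The delta shock\<close>

text \<open>Squaring \<open>sqrt \<rho>\<^sub>m * (u\<^sub>m - \<sigma>) = sqrt \<rho>\<^sub>p * (\<sigma> - u\<^sub>p)\<close>, which is the definition of \<open>\<sigma>\<close>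
  rearranged, gives the equation \<open>\<sigma>\<^sup>2 [\<rho>] - 2 \<sigma> [\<rho> u] + [\<rho> u\<^sup>2] = 0\<close>. It makes the weight of the momentum equal to \<open>\<sigma>\<close> times
  the weight of the density, as a singular part moving with velocity \<open>\<sigma>\<close> requires.\<close>

lemma delta_shock_speed_balance:
  fixes \<rho>\<^sub>m u\<^sub>m \<rho>\<^sub>p u\<^sub>p :: real
  assumes "0 < \<rho>\<^sub>m" "0 < \<rho>\<^sub>p"
    and \<sigma>: "\<sigma> = (sqrt \<rho>\<^sub>m * u\<^sub>m + sqrt \<rho>\<^sub>p * u\<^sub>p) / (sqrt \<rho>\<^sub>m + sqrt \<rho>\<^sub>p)"
  shows "\<sigma> * (\<rho>\<^sub>p * u\<^sub>p - \<rho>\<^sub>m * u\<^sub>m) - (\<rho>\<^sub>p * u\<^sub>p\<^sup>2 - \<rho>\<^sub>m * u\<^sub>m\<^sup>2)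
       = \<sigma> * (\<sigma> * (\<rho>\<^sub>p - \<rho>\<^sub>m) - (\<rho>\<^sub>p * u\<^sub>p - \<rho>\<^sub>m * u\<^sub>m))"
proof -
  have "0 < sqrt \<rho>\<^sub>m + sqrt \<rho>\<^sub>p" using assms by (simp add: add_pos_pos)
  then have "sqrt \<rho>\<^sub>m * (u\<^sub>m - \<sigma>) = sqrt \<rho>\<^sub>p * (\<sigma> - u\<^sub>p)"
    unfolding \<sigma> by (simp add: field_simps)
  then have "(sqrt \<rho>\<^sub>m * (u\<^sub>m - \<sigma>))\<^sup>2 = (sqrt \<rho>\<^sub>p * (\<sigma> - u\<^sub>p))\<^sup>2" by simp
  then have "\<rho>\<^sub>m * (u\<^sub>m - \<sigma>)\<^sup>2 = \<rho>\<^sub>p * (\<sigma> - u\<^sub>p)\<^sup>2"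
    using assms by (simp add: power_mult_distrib)
  then show ?thesis by (simp add: power2_eq_square algebra_simps)
qed

lemma delta_shock_speed_entropy:
  fixes \<rho>\<^sub>m u\<^sub>m \<rho>\<^sub>p u\<^sub>p :: real
  assumes "0 < \<rho>\<^sub>m" "0 < \<rho>\<^sub>p" "u\<^sub>p < u\<^sub>m"
    and \<sigma>: "\<sigma> = (sqrt \<rho>\<^sub>m * u\<^sub>m + sqrt \<rho>\<^sub>p * u\<^sub>p) / (sqrt \<rho>\<^sub>m + sqrt \<rho>\<^sub>p)"
  shows "u\<^sub>p < \<sigma>" "\<sigma> < u\<^sub>m"
proof -
  have "0 < sqrt \<rho>\<^sub>m" "0 < sqrt \<rho>\<^sub>p" using assms by auto
  then show "u\<^sub>p < \<sigma>" "\<sigma> < u\<^sub>m"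
    unfolding \<sigma> using assms(3) by (simp_all add: field_simps add_pos_pos)
qed

text \<open>The existentially quantified intermediate states and speeds, as functions of the parameters.
  For parameters without a two-shock solution their values are arbitrary.\<close>

lemma two_shock_solution_choice:
  obtains r v s\<^sub>1 s\<^sub>2 :: "real \<times> real \<Rightarrow> real" where
    "\<And>i. two_shock_solution \<gamma> (fst i) (snd i) \<rho>\<^sub>m u\<^sub>m \<rho>\<^sub>p u\<^sub>p (\<rho> i) (u i) \<Longrightarrow>
        backward_shock \<gamma> (fst i) (snd i) (s\<^sub>1 i) \<rho>\<^sub>m u\<^sub>m (r i) (v i) \<and>
        forward_shock \<gamma> (fst i) (snd i) (s\<^sub>2 i) (r i) (v i) \<rho>\<^sub>p u\<^sub>p \<and>
        (\<forall>\<xi>. (\<xi> < s\<^sub>1 i \<longrightarrow> \<rho> i \<xi> = \<rho>\<^sub>m \<and> u i \<xi> = u\<^sub>m) \<and>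
             (s\<^sub>1 i < \<xi> \<and> \<xi> < s\<^sub>2 i \<longrightarrow> \<rho> i \<xi> = r i \<and> u i \<xi> = v i) \<and>
             (s\<^sub>2 i < \<xi> \<longrightarrow> \<rho> i \<xi> = \<rho>\<^sub>p \<and> u i \<xi> = u\<^sub>p))"
proof -
  let ?P = "\<lambda>i r v s\<^sub>1 s\<^sub>2.
        two_shock_solution \<gamma> (fst i) (snd i) \<rho>\<^sub>m u\<^sub>m \<rho>\<^sub>p u\<^sub>p (\<rho> i) (u i) \<longrightarrow>
        backward_shock \<gamma> (fst i) (snd i) s\<^sub>1 \<rho>\<^sub>m u\<^sub>m r v \<and>
        forward_shock \<gamma> (fst i) (snd i) s\<^sub>2 r v \<rho>\<^sub>p u\<^sub>p \<and>
        (\<forall>\<xi>. (\<xi> < s\<^sub>1 \<longrightarrow> \<rho> i \<xi> = \<rho>\<^sub>m \<and> u i \<xi> = u\<^sub>m) \<and>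
             (s\<^sub>1 < \<xi> \<and> \<xi> < s\<^sub>2 \<longrightarrow> \<rho> i \<xi> = r \<and> u i \<xi> = v) \<and>
             (s\<^sub>2 < \<xi> \<longrightarrow> \<rho> i \<xi> = \<rho>\<^sub>p \<and> u i \<xi> = u\<^sub>p))"
  have "\<forall>i. \<exists>r v s\<^sub>1 s\<^sub>2. ?P i r v s\<^sub>1 s\<^sub>2" by (auto simp: two_shock_solution_def)
  then have "\<exists>r v s\<^sub>1 s\<^sub>2. \<forall>i. ?P i (r i) (v i) (s\<^sub>1 i) (s\<^sub>2 i)"
    by (simp only: choice_iff)
  then show thesis using that by blast
qed

theorem theorem5p5:
  fixes \<gamma> \<rho>\<^sub>m u\<^sub>m \<rho>\<^sub>p u\<^sub>p \<sigma> :: real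
    and \<rho> u :: "real \<Rightarrow> real \<Rightarrow> real \<Rightarrow> real"
    and w v :: "real \<Rightarrow> real"
    and R M :: "(real \<times> real \<Rightarrow> real) \<Rightarrow> real"
  assumes "\<gamma> > 1" and "\<rho>\<^sub>m > 0" and "\<rho>\<^sub>p > 0" and "u\<^sub>p < u\<^sub>m"
    and "\<forall>\<^sub>F (\<epsilon>\<^sub>1, \<epsilon>\<^sub>2) in at_right 0 \<times>\<^sub>F at_right 0.
           two_shock_solution \<gamma> \<epsilon>\<^sub>1 \<epsilon>\<^sub>2 \<rho>\<^sub>m u\<^sub>m \<rho>\<^sub>p u\<^sub>p (\<rho> \<epsilon>\<^sub>1 \<epsilon>\<^sub>2) (u \<epsilon>\<^sub>1 \<epsilon>\<^sub>2)"
    and "\<sigma> = (sqrt \<rho>\<^sub>m * u\<^sub>m + sqrt \<rho>\<^sub>p * u\<^sub>p) / (sqrt \<rho>\<^sub>m + sqrt \<rho>\<^sub>p)"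
    and "w = (\<lambda>t. t / sqrt (1 + \<sigma>\<^sup>2) *
                (\<sigma> * (\<rho>\<^sub>p - \<rho>\<^sub>m) - (\<rho>\<^sub>p * u\<^sub>p - \<rho>\<^sub>m * u\<^sub>m)))"
    and "v = (\<lambda>t. t / sqrt (1 + \<sigma>\<^sup>2) *
                (\<sigma> * (\<rho>\<^sub>p * u\<^sub>p - \<rho>\<^sub>m * u\<^sub>m) - (\<rho>\<^sub>p * u\<^sub>p\<^sup>2 - \<rho>\<^sub>m * u\<^sub>m\<^sup>2)))"
    and "R = (\<lambda>\<phi>. regular_distr (step \<sigma> \<rho>\<^sub>m \<rho>\<^sub>p) \<phi> + delta_distr \<sigma> w \<phi>)"
    and "M = (\<lambda>\<phi>. regular_distr (step \<sigma> (\<rho>\<^sub>m * u\<^sub>m) (\<rho>\<^sub>p * u\<^sub>p)) \<phi> + delta_distr \<sigma> v \<phi>)"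
  shows "converges_in_distributions (\<lambda>(\<epsilon>\<^sub>1, \<epsilon>\<^sub>2) (t, x). \<rho> \<epsilon>\<^sub>1 \<epsilon>\<^sub>2 (x / t)) R
           (at_right 0 \<times>\<^sub>F at_right 0) \<and>
         converges_in_distributions
           (\<lambda>(\<epsilon>\<^sub>1, \<epsilon>\<^sub>2) (t, x). \<rho> \<epsilon>\<^sub>1 \<epsilon>\<^sub>2 (x / t) * u \<epsilon>\<^sub>1 \<epsilon>\<^sub>2 (x / t)) M
           (at_right 0 \<times>\<^sub>F at_right 0) \<and>
         delta_shock_solution \<rho>\<^sub>m u\<^sub>m \<rho>\<^sub>p u\<^sub>p \<sigma> w R M"
proof -
  let ?F = "at_right (0::real) \<times>\<^sub>F at_right (0::real)"
  define k where "k = \<sigma> * (\<rho>\<^sub>p - \<rho>\<^sub>m) - (\<rho>\<^sub>p * u\<^sub>p - \<rho>\<^sub>m * u\<^sub>m)"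
  have balance: "\<sigma> * (\<rho>\<^sub>p * u\<^sub>p - \<rho>\<^sub>m * u\<^sub>m) - (\<rho>\<^sub>p * u\<^sub>p\<^sup>2 - \<rho>\<^sub>m * u\<^sub>m\<^sup>2) = \<sigma> * k"
    unfolding k_def by (rule delta_shock_speed_balance[OF assms(2,3,6)])
  have w: "w = (\<lambda>t. t / sqrt (1 + \<sigma>\<^sup>2) * k)" using assms(7) by (simp add: k_def)
  have v: "v = (\<lambda>t. t / sqrt (1 + \<sigma>\<^sup>2) * (\<sigma> * k))" using assms(8) by (simp add: balance)
  have R: "R \<psi> = regular_distr (step \<sigma> \<rho>\<^sub>m \<rho>\<^sub>p) \<psi> + k * ray_moment \<psi> \<sigma>"
    and M: "M \<psi> = regular_distr (step \<sigma> (\<rho>\<^sub>m * u\<^sub>m) (\<rho>\<^sub>p * u\<^sub>p)) \<psi> + \<sigma> * k * ray_moment \<psi> \<sigma>"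
    if "supported_in_box a b L \<psi>" for a b L \<psi>
    using delta_distr_linear_weight[OF that] by (simp_all add: assms(9,10) w v)

  define \<rho>' u' where "\<rho>' i = \<rho> (fst i) (snd i)" and "u' i = u (fst i) (snd i)" for i
  obtain r us s\<^sub>1 s\<^sub>2 :: "real \<times> real \<Rightarrow> real" where shocks:
    "\<And>i. two_shock_solution \<gamma> (fst i) (snd i) \<rho>\<^sub>m u\<^sub>m \<rho>\<^sub>p u\<^sub>p (\<rho>' i) (u' i) \<Longrightarrow>
        backward_shock \<gamma> (fst i) (snd i) (s\<^sub>1 i) \<rho>\<^sub>m u\<^sub>m (r i) (us i) \<and>
        forward_shock \<gamma> (fst i) (snd i) (s\<^sub>2 i) (r i) (us i) \<rho>\<^sub>p u\<^sub>p \<and>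
        (\<forall>\<xi>. (\<xi> < s\<^sub>1 i \<longrightarrow> \<rho>' i \<xi> = \<rho>\<^sub>m \<and> u' i \<xi> = u\<^sub>m) \<and>
             (s\<^sub>1 i < \<xi> \<and> \<xi> < s\<^sub>2 i \<longrightarrow> \<rho>' i \<xi> = r i \<and> u' i \<xi> = us i) \<and>
             (s\<^sub>2 i < \<xi> \<longrightarrow> \<rho>' i \<xi> = \<rho>\<^sub>p \<and> u' i \<xi> = u\<^sub>p))"
    by (rule two_shock_solution_choice[where \<gamma>=\<gamma> and \<rho>\<^sub>m=\<rho>\<^sub>m and u\<^sub>m=u\<^sub>m and \<rho>\<^sub>p=\<rho>\<^sub>p
          and u\<^sub>p=u\<^sub>p and \<rho>=\<rho>' and u=u']) (rule that, blast)
  have sol: "\<forall>\<^sub>F i in ?F. two_shock_solution \<gamma> (fst i) (snd i) \<rho>\<^sub>m u\<^sub>m \<rho>\<^sub>p u\<^sub>p (\<rho>' i) (u' i)"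
    using assms(5) by (simp add: \<rho>'_def u'_def split_beta')
  have bwd: "\<forall>\<^sub>F i in ?F. backward_shock \<gamma> (fst i) (snd i) (s\<^sub>1 i) \<rho>\<^sub>m u\<^sub>m (r i) (us i)"
    and fwd: "\<forall>\<^sub>F i in ?F. forward_shock \<gamma> (fst i) (snd i) (s\<^sub>2 i) (r i) (us i) \<rho>\<^sub>p u\<^sub>p"
    using sol by (auto elim!: eventually_mono dest: shocks)
  interpret two_shock_limit \<gamma> \<rho>\<^sub>m u\<^sub>m \<rho>\<^sub>p u\<^sub>p \<sigma> fst snd r us s\<^sub>1 s\<^sub>2 ?F
    by unfold_locales (fact assms bwd fwd filterlim_fst filterlim_snd)+
  have states: "\<forall>\<^sub>F i in ?F. three_states (s\<^sub>1 i) (s\<^sub>2 i) \<rho>\<^sub>m (r i) \<rho>\<^sub>p (\<rho>' i)"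
    "\<forall>\<^sub>F i in ?F. three_states (s\<^sub>1 i) (s\<^sub>2 i) (\<rho>\<^sub>m * u\<^sub>m) (r i * us i) (\<rho>\<^sub>p * u\<^sub>p) (\<lambda>\<xi>. \<rho>' i \<xi> * u' i \<xi>)"
    using sol shock_speeds_ordered by (eventually_elim, use shocks in \<open>simp add: three_states_def\<close>)+
  have mass: "((\<lambda>i. r i * (s\<^sub>2 i - s\<^sub>1 i)) \<longlongrightarrow> k) ?F"
    unfolding k_def by (rule intermediate_mass_tendsto)
  have momentum: "((\<lambda>i. r i * us i * (s\<^sub>2 i - s\<^sub>1 i)) \<longlongrightarrow> \<sigma> * k) ?F"
    unfolding balance[symmetric] by (rule intermediate_momentum_tendsto)

  have "converges_in_distributions (\<lambda>(\<epsilon>\<^sub>1, \<epsilon>\<^sub>2) (t, x). \<rho> \<epsilon>\<^sub>1 \<epsilon>\<^sub>2 (x / t)) R ?F"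
    unfolding converges_in_distributions_def
  proof (intro allI impI)
    fix \<phi> assume "test_function \<phi>"
    then obtain a b L where box: "supported_in_box a b L \<phi>" by (rule test_function_supported_in_box)
    show "((\<lambda>i. regular_distr (case i of (\<epsilon>\<^sub>1, \<epsilon>\<^sub>2) \<Rightarrow> \<lambda>(t, x). \<rho> \<epsilon>\<^sub>1 \<epsilon>\<^sub>2 (x / t)) \<phi>) \<longlongrightarrow> R \<phi>) ?F"
      unfolding R[OF box]
      by (rule three_states_tendsto_delta[OF box shock_speeds_tendsto states(1) _ mass])
        (simp add: \<rho>'_def split_beta)
  qed
  moreover have "converges_in_distributions
      (\<lambda>(\<epsilon>\<^sub>1, \<epsilon>\<^sub>2) (t, x). \<rho> \<epsilon>\<^sub>1 \<epsilon>\<^sub>2 (x / t) * u \<epsilon>\<^sub>1 \<epsilon>\<^sub>2 (x / t)) M ?F"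
    unfolding converges_in_distributions_def
  proof (intro allI impI)
    fix \<phi> assume "test_function \<phi>"
    then obtain a b L where box: "supported_in_box a b L \<phi>" by (rule test_function_supported_in_box)
    show "((\<lambda>i. regular_distr (case i of (\<epsilon>\<^sub>1, \<epsilon>\<^sub>2) \<Rightarrow>
        \<lambda>(t, x). \<rho> \<epsilon>\<^sub>1 \<epsilon>\<^sub>2 (x / t) * u \<epsilon>\<^sub>1 \<epsilon>\<^sub>2 (x / t)) \<phi>) \<longlongrightarrow> M \<phi>) ?F"
      unfolding M[OF box]
      by (rule three_states_tendsto_delta[OF box shock_speeds_tendsto states(2) _ momentum])
        (simp add: \<rho>'_def u'_def split_beta)
  qed
  moreover have "delta_shock_solution \<rho>\<^sub>m u\<^sub>m \<rho>\<^sub>p u\<^sub>p \<sigma> w R M"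
  proof -
    define Q where "Q \<phi> = regular_distr (step \<sigma> (\<rho>\<^sub>m * u\<^sub>m\<^sup>2) (\<rho>\<^sub>p * u\<^sub>p\<^sup>2)) \<phi>
      + delta_distr \<sigma> (\<lambda>t. \<sigma>\<^sup>2 * w t) \<phi>" for \<phi>
    have sv: "v = (\<lambda>t. \<sigma> * w t)" and s2w: "(\<lambda>t. \<sigma>\<^sup>2 * w t) = (\<lambda>t. t / sqrt (1 + \<sigma>\<^sup>2) * (\<sigma>\<^sup>2 * k))"
      by (simp_all add: v w fun_eq_iff)
    have Q: "Q \<psi> = regular_distr (step \<sigma> (\<rho>\<^sub>m * u\<^sub>m\<^sup>2) (\<rho>\<^sub>p * u\<^sub>p\<^sup>2)) \<psi> + \<sigma>\<^sup>2 * k * ray_moment \<psi> \<sigma>"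
      if "supported_in_box a b L \<psi>" for a b L \<psi>
      unfolding Q_def s2w by (simp only: delta_distr_linear_weight[OF that])
    have weak: "R (partial_t \<phi>) + M (partial_x \<phi>) = 0 \<and> M (partial_t \<phi>) + Q (partial_x \<phi>) = 0"
      if \<phi>: "test_function \<phi>" for \<phi>
    proof -
      obtain a b L where box: "supported_in_box a b L \<phi>" "supported_in_box a b L (partial_t \<phi>)" "supported_in_box a b L (partial_x \<phi>)"
        by (rule test_function_supported_in_box[OF \<phi>])
      define h where "h = ray_integral \<phi> \<sigma>"
      have parts: "ray_moment (partial_t \<phi>) \<sigma> = - h - \<sigma> * ray_moment (partial_x \<phi>) \<sigma>"
        using ray_moment_by_parts[OF \<phi> box, of \<sigma>] by (simp add: h_def)
      have "R (partial_t \<phi>) + M (partial_x \<phi>)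
          = (\<sigma> * (\<rho>\<^sub>p - \<rho>\<^sub>m) - (\<rho>\<^sub>p * u\<^sub>p - \<rho>\<^sub>m * u\<^sub>m) - k) * h"
        unfolding R[OF box(2)] M[OF box(3)] regular_distr_step_partials[OF \<phi>] parts h_def[symmetric]
        by (simp add: algebra_simps)
      moreover have "M (partial_t \<phi>) + Q (partial_x \<phi>)
          = (\<sigma> * (\<rho>\<^sub>p * u\<^sub>p - \<rho>\<^sub>m * u\<^sub>m) - (\<rho>\<^sub>p * u\<^sub>p\<^sup>2 - \<rho>\<^sub>m * u\<^sub>m\<^sup>2) - \<sigma> * k) * h"
        unfolding M[OF box(2)] Q[OF box(3)] regular_distr_step_partials[OF \<phi>] parts h_def[symmetric]
        by (simp add: algebra_simps power2_eq_square)
      ultimately show ?thesis unfolding balance by (simp add: k_def)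
    qed
    show ?thesis
      unfolding delta_shock_solution_def
    proof (intro conjI exI[of _ Q] allI impI)
      show "u\<^sub>p < \<sigma>" "\<sigma> < u\<^sub>m"
        using delta_shock_speed_entropy[OF assms(2-4,6)] by auto
      show "R (partial_t \<phi>) + M (partial_x \<phi>) = 0" "M (partial_t \<phi>) + Q (partial_x \<phi>) = 0"
        if "test_function \<phi>" for \<phi>
        using weak[OF that] by auto
    qed (simp_all add: assms(9,10) sv[symmetric] Q_def)
  qed
  ultimately show ?thesis by blast
qed

end
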